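(* Let $A \in \mathbb{C}^{n\times n}$. Let $U \subset \mathbb{R}$ be an open interval containing $0$ such that for every $\mu_0 \in \Lambda(A)$ there is a real number $r(\mu_0) > 0$ such that $A + \eta\Delta$ has only one eigenvalue in $B_{r(\mu_0)}(\mu_0)$, which is simple, for every $\eta \in U$ and every $\Delta \in \mathbb{C}^{n\times n}$ with $\|\Delta\|_F \leq 1$. Suppose also $\epsilon > 0$ is small enough so that $[0,\epsilon] \subset U$. Then $$\alpha_\epsilon(A) = \max\{ \widetilde{\mathcal{R}}(\epsilon;\mu_0) : \mu_0 \in \Lambda(A) \}$$ $$= \max_{\mu_0 \in \Lambda(A)} \left\{ \mathrm{Re}\{ \mu(\epsilon; \widetilde{\Delta}^{\mu_0}_\ast, \mu_0) \} \right\} + \mathcal{O}(\epsilon^3)$$ $$= \max_{\mu_0 \in \Lambda(A)} \left\{ \alpha\left( A + \epsilon \widetilde{\Delta}^{\mu_0}_\ast \right) \right\} + \mathcal{O}(\epsilon^3)$$ $$= \max_{\mu_0 \in \Lambda(A)} \left\{ \mathrm{Re}\{\mu_0\} + \frac{\epsilon}{y_{\mu_0}^\ast x_{\mu_0}} \mathrm{Re}\left[ \left\langle y_{\mu_0} x_{\mu_0}^\ast + \frac{\epsilon}{2}\left\{ \widetilde{y}^{\,\mu_0}_p x_{\mu_0}^\ast + y_{\mu_0} (\widetilde{x}^{\,\mu_0}_p)^\ast + \widetilde{\beta}^{\,\mu_0}_p \, y_{\mu_0} x_{\mu_0}^\ast \right\}, \; \widetilde{\Delta}^{\mu_0}_\ast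 \right\rangle \right] \right\} + \mathcal{O}(\epsilon^3).$$ Here $x_{\mu_0}$ and $y_{\mu_0}$ denote a unit right eigenvector and a unit left eigenvector, respectively, of $A$ corresponding to its eigenvalue $\mu_0$, normalized such that $y_{\mu_0}^\ast x_{\mu_0}$ is real and positive; $$\widetilde{x}^{\,\mu_0}_p = \frac{x(h; y_{\mu_0}x_{\mu_0}^\ast, \mu_0) - x_{\mu_0}}{h}, \qquad \widetilde{y}^{\,\mu_0}_p = \frac{y(h; y_{\mu_0}x_{\mu_0}^\ast, \mu_0) - y_{\mu_0}}{h},$$ $$\widetilde{\beta}^{\,\mu_0}_p = \frac{-1}{y_{\mu_0}^\ast x_{\mu_0}} \left\{ (\widetilde{y}^{\,\mu_0}_p)^\ast x_{\mu_0} + y_{\mu_0}^\ast \widetilde{x}^{\,\mu_0}_p \right\}$$ for some positive $h = \mathcal{O}(\epsilon)$, where $x(\eta;\Delta,\mu_0)$ and $y(\eta;\Delta,\mu_0)$ denote analytic (in $\eta$) unit right and unit left eigenvectors of $A + \eta\Delta$ (corresponding to its eigenvalue $\mu(\eta;\Delta,\mu_0)$) such that $y(\eta;\Delta,\mu_0)^\ast x(\eta;\Delta,\mu_0)$ is real and positive, $x(0;\Delta,\mu_0) = x_{\mu_0}$, $y(0;\Delta,\mu_0) = y_{\mu_0}$; and $$\widetilde{\Delta}^{\mu_0}_\ast = \frac{ y_{\mu_0} x_{\mu_0}^\ast + \frac{\epsilon}{2}\left\{ \widetilde{y}^{\,\mu_0}_p x_{\mu_0}^\ast + y_{\mu_0}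 (\widetilde{x}^{\,\mu_0}_p)^\ast + \widetilde{\beta}^{\,\mu_0}_p \, y_{\mu_0} x_{\mu_0}^\ast \right\} }{ \left\| y_{\mu_0} x_{\mu_0}^\ast + \frac{\epsilon}{2}\left\{ \widetilde{y}^{\,\mu_0}_p x_{\mu_0}^\ast + y_{\mu_0} (\widetilde{x}^{\,\mu_0}_p)^\ast + \widetilde{\beta}^{\,\mu_0}_p \, y_{\mu_0} x_{\mu_0}^\ast \right\} \right\|_F }.$$
   Context: $\Lambda(A)$ is the set of eigenvalues of $A$; $\alpha(F)$ is the spectral abscissa of a square matrix $F$ (largest real part of its eigenvalues); $\|\cdot\|_F$ is the Frobenius norm and $\langle F, G\rangle = \mathrm{trace}(F^\ast G)$; $B_r(z_0) = \{z \in \mathbb{C} : |z-z_0| < r\}$. The $\epsilon$-pseudospectrum is $\Lambda_\epsilon(A) = \bigcup_{\|\Delta\|_F \leq \epsilon} \Lambda(A+\Delta)$ (which equals $\bigcup_{\|\Delta\|_2 \leq \epsilon} \Lambda(A+\Delta)$), with $\Delta$ ranging over $\mathbb{C}^{n\times n}$, and $\alpha_\epsilon(A) = \max\{\mathrm{Re}(z) : z \in \Lambda_\epsilon(A)\}$. For $\mu_0 \in \Lambda(A)$, $\eta \in U$ and $\|\Delta\|_F \leq 1$, $\mu(\eta;\Delta,\mu_0)$ denotes the unique eigenvalue of $A+\eta\Delta$ in $B_{r(\mu_0)}(\mu_0)$ (a real-analytic function of $\eta\in U$ with value $\mu_0$ at $\eta = 0$), and $\widetilde{\mathcal{R}}(\epsilon;\mu_0)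 = \max_{\|\Delta\|_F \leq 1} \mathrm{Re}\{\mu(\epsilon;\Delta,\mu_0)\}$. A unit left eigenvector $y$ of a matrix $F$ for an eigenvalue $\mu$ satisfies $\|y\|_2 = 1$, $y^\ast F = \mu y^\ast$. Order terms are understood as $\epsilon \to 0^+$ with $A$ fixed. *)

theory Defs
  imports
    "HOL-Analysis.Analysis"
    "HOL-Computational_Algebra.Polynomial"
    "HOL-Library.Landau_Symbols"
begin

section \<open>Complex matrices\<close>

definition cvec_conj :: "complex ^ 'n \<Rightarrow> complex ^ 'n" where
  "cvec_conj v = (\<chi> i. cnj (v $ i))"

text \<open>The product \<open>y\<^sup>* x\<close>, conjugate-linear in its first argument.\<close>
definition cdot :: "complex ^ 'n \<Rightarrow> complex ^ 'n \<Rightarrow> complex" where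
  "cdot y x = (\<Sum>i\<in>UNIV. cnj (y $ i) * x $ i)"

text \<open>The rank-one matrix \<open>y x\<^sup>*\<close>.\<close>
definition outer :: "complex ^ 'n \<Rightarrow> complex ^ 'n \<Rightarrow> complex ^ 'n ^ 'n" where
  "outer y x = (\<chi> i j. y $ i * cnj (x $ j))"

definition cmat_scale :: "complex \<Rightarrow> complex ^ 'n ^ 'n \<Rightarrow> complex ^ 'n ^ 'n" where
  "cmat_scale c F = map_matrix (\<lambda>z. c * z) F"

definition cadjoint :: "complex ^ 'n ^ 'n \<Rightarrow> complex ^ 'n ^ 'n" where
  "cadjoint F = transpose (map_matrix cnj F)"

definition mat_inner :: "complex ^ 'n ^ 'n \<Rightarrow> complex ^ 'n ^ 'n \<Rightarrow> complex" where
  "mat_inner F G = trace (cadjoint F ** G)"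

text \<open>
  The library norm on \<open>complex ^ 'n ^ 'n\<close> is the Frobenius norm, and the one on
  \<open>complex ^ 'n\<close> is the Euclidean norm; both are used as such below.
\<close>
lemma norm_eq_frobenius:
  fixes F :: "complex ^ 'n ^ 'n"
  shows "norm F = sqrt (\<Sum>i\<in>UNIV. \<Sum>j\<in>UNIV. (cmod (F $ i $ j))\<^sup>2)"
  by (simp add: norm_vec_def L2_set_def sum_nonneg)

lemma mat_inner_self:
  fixes F :: "complex ^ 'n ^ 'n"
  shows "mat_inner F F = of_real ((norm F)\<^sup>2)"
proof -
  have "mat_inner F F = (\<Sum>j\<in>UNIV. \<Sum>i\<in>UNIV. of_real ((cmod (F $ i $ j))\<^sup>2))"
    by (simp add: mat_inner_def cadjoint_def trace_def matrix_matrix_mult_def transpose_def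
        complex_norm_square mult.commute del: of_real_power)
  also have "\<dots> = of_real (\<Sum>i\<in>UNIV. \<Sum>j\<in>UNIV. (cmod (F $ i $ j))\<^sup>2)"
    by (subst sum.swap) simp
  also have "\<dots> = of_real ((norm F)\<^sup>2)"
    by (simp add: norm_eq_frobenius sum_nonneg)
  finally show ?thesis .
qed


section \<open>Eigenvalues, eigenvectors and pseudospectra\<close>

definition eigenvalues :: "complex ^ 'n ^ 'n \<Rightarrow> complex set" where
  "eigenvalues F = {\<mu>. \<exists>v. v \<noteq> 0 \<and> F *v v = \<mu> *s v}"

definition charpoly :: "complex ^ 'n ^ 'n \<Rightarrow> complex poly" where
  "charpoly F = det (mat [:0, 1:] - map_matrix (\<lambda>z. [:z:]) F)"

text \<open>A simple eigenvalue is one of algebraic multiplicity one.\<close>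
definition simple_eigenvalue :: "complex ^ 'n ^ 'n \<Rightarrow> complex \<Rightarrow> bool" where
  "simple_eigenvalue F \<mu> \<longleftrightarrow> \<mu> \<in> eigenvalues F \<and> order \<mu> (charpoly F) = 1"

lemma poly_charpoly: "poly (charpoly F) \<mu> = det (mat \<mu> - F)"
proof -
  have "poly ((mat [:0, 1:] - map_matrix (\<lambda>z. [:z:]) F) $ i $ j) \<mu> = (mat \<mu> - F) $ i $ j" for i j
    by (simp add: mat_def)
  then show ?thesis
    by (simp add: charpoly_def det_def poly_sum poly_prod)
qed

definition spectral_abscissa :: "complex ^ 'n ^ 'n \<Rightarrow> real" where
  "spectral_abscissa F = Max (Re ` eigenvalues F)"

definition pseudospectrum :: "real \<Rightarrow> complex ^ 'n ^ 'n \<Rightarrow> complex set" where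
  "pseudospectrum \<epsilon> A = (\<Union>\<Delta>\<in>{\<Delta>. norm \<Delta> \<le> \<epsilon>}. eigenvalues (A + \<Delta>))"

text \<open>
  Over the infinite sets here and in \<open>max_Re_eigenvalue\<close>, the maximum is the greatest element
  (\<open>Max\<close> is meaningful for finite sets only).
\<close>
definition pseudospectral_abscissa :: "real \<Rightarrow> complex ^ 'n ^ 'n \<Rightarrow> real" where
  "pseudospectral_abscissa \<epsilon> A = (GREATEST t. t \<in> Re ` pseudospectrum \<epsilon> A)"

text \<open>
  \<open>\<mu>(\<eta>; \<Delta>, \<mu>\<^sub>0)\<close>, the unique eigenvalue of \<open>A + \<eta>\<Delta>\<close> in the open disk of radius \<open>r(\<mu>\<^sub>0)\<close> about
  \<open>\<mu>\<^sub>0\<close>; unspecified if there is no such unique eigenvalue.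
\<close>
definition pert_eigenvalue ::
  "complex ^ 'n ^ 'n \<Rightarrow> (complex \<Rightarrow> real) \<Rightarrow> real \<Rightarrow> complex ^ 'n ^ 'n \<Rightarrow> complex \<Rightarrow> complex" where
  "pert_eigenvalue A r \<eta> \<Delta> \<mu>0 =
     (THE \<mu>. \<mu> \<in> eigenvalues (A + \<eta> *\<^sub>R \<Delta>) \<inter> ball \<mu>0 (r \<mu>0))"

text \<open>The quantity \<open>R\<^sup>~(\<epsilon>; \<mu>\<^sub>0)\<close>.\<close>
definition max_Re_eigenvalue ::
  "complex ^ 'n ^ 'n \<Rightarrow> (complex \<Rightarrow> real) \<Rightarrow> real \<Rightarrow> complex \<Rightarrow> real" where
  "max_Re_eigenvalue A r \<epsilon> \<mu>0 =
     (GREATEST t. t \<in> (\<lambda>\<Delta>. Re (pert_eigenvalue A r \<epsilon> \<Delta> \<mu>0)) ` {\<Delta>. norm \<Delta> \<le> 1})"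

text \<open>
  \<open>x\<close> and \<open>y\<close> are unit right and left eigenvectors, \<open>F x = \<mu> x\<close> and \<open>y\<^sup>* F = \<mu> y\<^sup>*\<close>, with
  \<open>y\<^sup>* x\<close> real and positive.
\<close>
definition unit_eigenpair ::
  "complex ^ 'n ^ 'n \<Rightarrow> complex \<Rightarrow> complex ^ 'n \<Rightarrow> complex ^ 'n \<Rightarrow> bool" where
  "unit_eigenpair F \<mu> x y \<longleftrightarrow>
     norm x = 1 \<and> F *v x = \<mu> *s x \<and>
     norm y = 1 \<and> cvec_conj y v* F = \<mu> *s cvec_conj y \<and>
     cdot y x \<in> \<real> \<and> Re (cdot y x) > 0"

text \<open>
  Analyticity in a real variable; the library's \<open>analytic_on\<close> is about complex differentiability.
\<close>
definition real_analytic_on :: "(real \<Rightarrow> 'a::real_normed_vector) \<Rightarrow> real set \<Rightarrow> bool"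
    (infixl \<open>real'_analytic'_on\<close> 50) where
  "f real_analytic_on S \<longleftrightarrow>
     (\<forall>t\<in>S. \<exists>\<rho>>0. \<exists>c. \<forall>s. \<bar>s - t\<bar> < \<rho> \<longrightarrow> (\<lambda>k. (s - t) ^ k *\<^sub>R c k) sums f s)"


section \<open>The approximate maximizer\<close>

text \<open>
  Below, \<open>xA \<mu>0\<close> and \<open>yA \<mu>0\<close> stand for the eigenvectors \<open>x\<^bsub>\<mu>\<^sub>0\<^esub>\<close> and \<open>y\<^bsub>\<mu>\<^sub>0\<^esub>\<close> of \<open>A\<close>, and
  \<open>x \<eta> \<Delta> \<mu>0\<close> and \<open>y \<eta> \<Delta> \<mu>0\<close> for those of \<open>A + \<eta>\<Delta>\<close>.
\<close>
definition eigvec_quotient ::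
  "(complex \<Rightarrow> complex ^ 'n) \<Rightarrow> (real \<Rightarrow> complex ^ 'n ^ 'n \<Rightarrow> complex \<Rightarrow> complex ^ 'n) \<Rightarrow>
   complex ^ 'n ^ 'n \<Rightarrow> real \<Rightarrow> complex \<Rightarrow> complex ^ 'n" where
  "eigvec_quotient vA v \<Delta> h \<mu>0 = (v h \<Delta> \<mu>0 - vA \<mu>0) /\<^sub>R h"

text \<open>The matrix whose normalization is the approximate maximizer.\<close>
definition ascent_matrix ::
  "(complex \<Rightarrow> complex ^ 'n) \<Rightarrow> (complex \<Rightarrow> complex ^ 'n) \<Rightarrow>
   (real \<Rightarrow> complex ^ 'n ^ 'n \<Rightarrow> complex \<Rightarrow> complex ^ 'n) \<Rightarrow>
   (real \<Rightarrow> complex ^ 'n ^ 'n \<Rightarrow> complex \<Rightarrow> complex ^ 'n) \<Rightarrow>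
   real \<Rightarrow> real \<Rightarrow> complex \<Rightarrow> complex ^ 'n ^ 'n" where
  "ascent_matrix xA yA x y h \<epsilon> \<mu>0 =
     (let D = outer (yA \<mu>0) (xA \<mu>0);
          xp = eigvec_quotient xA x D h \<mu>0;
          yp = eigvec_quotient yA y D h \<mu>0;
          \<beta>p = (- 1 / cdot (yA \<mu>0) (xA \<mu>0)) * (cdot yp (xA \<mu>0) + cdot (yA \<mu>0) xp)
      in D + (\<epsilon> / 2) *\<^sub>R (outer yp (xA \<mu>0) + outer (yA \<mu>0) xp + cmat_scale \<beta>p D))"

definition approx_maximizer ::
  "(complex \<Rightarrow> complex ^ 'n) \<Rightarrow> (complex \<Rightarrow> complex ^ 'n) \<Rightarrow>
   (real \<Rightarrow> complex ^ 'n ^ 'n \<Rightarrow> complex \<Rightarrow> complex ^ 'n) \<Rightarrow>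
   (real \<Rightarrow> complex ^ 'n ^ 'n \<Rightarrow> complex \<Rightarrow> complex ^ 'n) \<Rightarrow>
   real \<Rightarrow> real \<Rightarrow> complex \<Rightarrow> complex ^ 'n ^ 'n" where
  "approx_maximizer xA yA x y h \<epsilon> \<mu>0 =
     ascent_matrix xA yA x y h \<epsilon> \<mu>0 /\<^sub>R norm (ascent_matrix xA yA x y h \<epsilon> \<mu>0)"

end

theory Submission
  imports Defs "HOL-Computational_Algebra.Fundamental_Theorem_Algebra"
begin

text \<open>
  The first equality says that the eigenvalue branches exhaust the spectrum. All eigenvalues of \<open>A\<close>
  are simple, so there are \<open>n\<close> of them. Two branches \<open>\<mu>(\<eta>; \<Delta>, \<mu>\<^sub>0)\<close> and \<open>\<mu>(\<eta>; \<Delta>, \<mu>\<^sub>1)\<close> coincide on a set of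
  \<open>\<eta>\<close> that is open and closed in the interval \<open>U\<close> and does not contain \<open>0\<close>, hence never
  (\<open>eig_distinct\<close>). The \<open>n\<close> branches therefore give all eigenvalues of \<open>A + \<eta>\<Delta>\<close>
  (\<open>eigenvalues_perturbed\<close>), and the maxima exist by continuity and compactness.

  For the expansions, fix an eigenvalue \<open>\<mu>\<^sub>0\<close> of \<open>A\<close>, write \<open>x\<^sub>0, y\<^sub>0\<close> for its eigenvectors,
  \<open>\<kappa> = y\<^sub>0\<^sup>* x\<^sub>0\<close> and \<open>D = y\<^sub>0 x\<^sub>0\<^sup>*\<close>. Pairing the left eigenvector of \<open>A + \<epsilon>D\<close> with a right
  eigenvector of \<open>A + \<epsilon>\<Delta>\<close> gives, uniformly in \<open>\<Delta>\<close> of norm at most one (\<open>eigenvalue_difference\<close>),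
  \<open>Re \<mu>(\<epsilon>; \<Delta>) - Re \<mu>(\<epsilon>; D) = \<epsilon>/\<kappa> \<langle>D, \<Delta> - D\<rangle> + O(\<epsilon>\<^sup>2 \<parallel>\<Delta> - D\<parallel>)\<close>.
  On the unit ball \<open>\<langle>D, \<Delta> - D\<rangle> \<le> - \<parallel>\<Delta> - D\<parallel>\<^sup>2 / 2\<close>, with equality on the unit sphere. The
  quadratic loss beats the linear error term unless \<open>\<parallel>\<Delta> - D\<parallel> = O(\<epsilon>)\<close>, and in that range both terms
  are \<open>O(\<epsilon>\<^sup>3)\<close>. So every family of unit matrices within \<open>O(\<epsilon>)\<close> of \<open>D\<close> attains the maximum up to
  \<open>O(\<epsilon>\<^sup>3)\<close> (\<open>max_Re_near_optimal\<close>). The normalized ascent matrix is such a family because the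
  difference quotients of the eigenvectors stay bounded. This is the second expansion; the third one is
  squeezed between the first and the second.

  The last expansion needs the value of the maximum and not only a maximizer. The inner product of
  a nonzero matrix with its normalization is its norm, so the claim is that \<open>Re \<mu>(\<epsilon>; D)\<close> and
  \<open>Re \<mu>\<^sub>0 + (\<epsilon>/\<kappa>) \<parallel>M\<parallel>\<close>, with \<open>M\<close> the ascent matrix, have the same expansion. Pairing
  \<open>(A + \<epsilon>D) x(\<epsilon>) = \<mu> x(\<epsilon>)\<close> with \<open>y\<^sub>0\<close>, and the left eigenvector equation with \<open>x\<^sub>0\<close>, expresses
  \<open>\<mu>(\<epsilon>; D) - \<mu>\<^sub>0\<close> in two ways as a quotient; expanded and averaged, they have the real part
  \<open>\<epsilon>/\<kappa> (1 + \<epsilon>/2 Re \<beta>) + O(\<epsilon>\<^sup>3)\<close> (\<open>Re_eig_D_expansion\<close>). On the other side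
  \<open>\<parallel>M\<parallel> = 1 + \<epsilon>/2 Re \<beta> + O(\<epsilon>\<^sup>2)\<close> (\<open>norm_ascent_expansion\<close>), since for unit vectors the difference
  quotients are orthogonal to \<open>x\<^sub>0\<close> and \<open>y\<^sub>0\<close> up to \<open>O(\<epsilon>)\<close> in the real part.
\<close>

section \<open>Products of vectors and matrices\<close>

lemma cdot_add_left: "cdot (x + y) z = cdot x z + cdot y z"
  by (simp add: cdot_def distrib_right sum.distrib)

lemma cdot_add_right: "cdot x (y + z) = cdot x y + cdot x z"
  by (simp add: cdot_def distrib_left sum.distrib)

lemma cdot_diff_left: "cdot (x - y) z = cdot x z - cdot y z"
  by (simp add: cdot_def left_diff_distrib sum_subtractf)

lemma cdot_diff_right: "cdot x (y - z) = cdot x y - cdot x z"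
  by (simp add: cdot_def right_diff_distrib sum_subtractf)

lemma cdot_scale_right: "cdot x (c *s y) = c * cdot x y"
  by (simp add: cdot_def sum_distrib_left mult_ac)

lemma cdot_scaleR_left: "cdot (t *\<^sub>R x) y = of_real t * cdot x y"
  by (simp add: cdot_def sum_distrib_left scaleR_conv_of_real[where 'a=complex] mult_ac)

lemma cdot_scaleR_right: "cdot x (t *\<^sub>R y) = of_real t * cdot x y"
  by (simp add: cdot_def sum_distrib_left scaleR_conv_of_real[where 'a=complex] mult_ac)

lemma cdot_zero_right [simp]: "cdot x 0 = 0"
  by (simp add: cdot_def)

lemma cdot_self: "cdot x x = of_real ((norm x)\<^sup>2)"
proof -
  have "cdot x x = of_real (\<Sum>i\<in>UNIV. (cmod (x $ i))\<^sup>2)"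
    by (simp add: cdot_def complex_norm_square mult.commute del: of_real_power)
  then show ?thesis
    by (simp add: norm_vec_def L2_set_def sum_nonneg)
qed

lemma Re_cdot: "Re (cdot x y) = inner x y"
  by (simp add: cdot_def inner_vec_def inner_complex_def)

lemma norm_cdot_le: "cmod (cdot x y) \<le> norm x * norm y"
proof -
  have "cmod (cdot x y) \<le> (\<Sum>i\<in>UNIV. \<bar>cmod (x $ i)\<bar> * \<bar>cmod (y $ i)\<bar>)"
    unfolding cdot_def by (rule order_trans[OF norm_sum]) (simp add: norm_mult)
  also have "\<dots> \<le> norm x * norm y"
    unfolding norm_vec_def by (rule L2_set_mult_ineq)
  finally show ?thesis .
qed

lemma norm_vector_scale: "norm (c *s x) = cmod c * norm (x :: complex ^ 'n)"
  by (simp add: norm_vec_def L2_set_def norm_mult power_mult_distrib flip: sum_distrib_left)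
     (simp add: real_sqrt_mult)

lemma norm_outer: "norm (outer y x) = norm y * norm x"
proof -
  have "(norm (outer y x))\<^sup>2 = (norm y)\<^sup>2 * (norm x)\<^sup>2"
    by (simp add: norm_vec_def L2_set_def outer_def norm_mult power_mult_distrib sum_nonneg
        sum_product)
  then show ?thesis
    by (metis norm_ge_zero mult_nonneg_nonneg power2_eq_iff_nonneg power_mult_distrib)
qed

lemma norm_matrix_vector_le:
  fixes F :: "complex ^ 'n ^ 'n"
  shows "norm (F *v x) \<le> norm F * norm x"
proof -
  have row: "cmod ((F *v x) $ i) \<le> norm (F $ i) * norm x" for i
  proof -
    have "(F *v x) $ i = cdot (cvec_conj (F $ i)) x"
      by (simp add: matrix_vector_mult_def cdot_def cvec_conj_def)
    moreover have "norm (cvec_conj (F $ i)) = norm (F $ i)"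
      by (simp add: norm_vec_def cvec_conj_def)
    ultimately show ?thesis
      by (metis norm_cdot_le)
  qed
  have "norm (F *v x) \<le> L2_set (\<lambda>i. norm (F $ i) * norm x) UNIV"
    unfolding norm_vec_def[of "F *v x"] by (intro L2_set_mono row) auto
  also have "\<dots> = norm F * norm x"
    unfolding norm_vec_def[of F] by (simp add: L2_set_left_distrib)
  finally show ?thesis .
qed

lemma Re_mat_inner: "Re (mat_inner F G) = inner F G"
proof -
  have "mat_inner F G = (\<Sum>j\<in>UNIV. \<Sum>i\<in>UNIV. cnj (F $ i $ j) * G $ i $ j)"
    by (simp add: mat_inner_def cadjoint_def trace_def matrix_matrix_mult_def transpose_def)
  also have "\<dots> = (\<Sum>i\<in>UNIV. cdot (F $ i) (G $ i))"
    unfolding cdot_def by (rule sum.swap)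
  finally show ?thesis
    by (simp add: Re_cdot inner_vec_def[of F])
qed

lemma Re_cdot_matrix_vector: "Re (cdot y (F *v x)) = inner (outer y x) F"
proof -
  have "cdot y (F *v x) = (\<Sum>i\<in>UNIV. \<Sum>j\<in>UNIV. cnj (y $ i * cnj (x $ j)) * F $ i $ j)"
    by (simp add: cdot_def matrix_vector_mult_def sum_distrib_left mult_ac)
  also have "\<dots> = (\<Sum>i\<in>UNIV. cdot (outer y x $ i) (F $ i))"
    by (simp add: outer_def cdot_def)
  finally show ?thesis
    by (simp add: Re_cdot inner_vec_def[of "outer y x"])
qed

lemma outer_vector: "outer y x *v w = cdot x w *s y"
  by (simp add: vec_eq_iff outer_def matrix_vector_mult_def cdot_def sum_distrib_left mult_ac)

lemma norm_cmat_scale: "norm (cmat_scale c F) = cmod c * norm F"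
proof -
  have "cmat_scale c F $ i = c *s (F $ i)" for i
    by (simp add: vec_eq_iff cmat_scale_def)
  then have "norm (cmat_scale c F $ i) = cmod c * norm (F $ i)" for i
    by (simp add: norm_vector_scale)
  then show ?thesis
    by (simp add: norm_vec_def[of "cmat_scale c F"] norm_vec_def[of F] L2_set_right_distrib)
qed

lemma cmat_scale_vector: "cmat_scale c F *v x = c *s (F *v x)"
  by (simp add: vec_eq_iff cmat_scale_def matrix_vector_mult_def sum_distrib_left mult_ac)

lemma scaleR_matrix_vector: "(t *\<^sub>R F) *v x = t *\<^sub>R (F *v (x :: complex ^ 'n))"
  by (simp add: vec_eq_iff matrix_vector_mult_def scaleR_sum_right)

lemma matrix_vector_scaleR: "F *v (t *\<^sub>R x) = t *\<^sub>R (F *v (x :: complex ^ 'n))"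
  by (simp add: vec_eq_iff matrix_vector_mult_def scaleR_sum_right)

lemma cdot_matrix_diff_le:
  fixes F :: "complex ^ 'n ^ 'n"
  shows "cmod (cdot y (F *v v) - cdot y0 (F *v x0))
     \<le> (norm (y - y0) * norm v + norm y0 * norm (v - x0)) * norm F"
proof -
  have "cdot y (F *v v) - cdot y0 (F *v x0) = cdot (y - y0) (F *v v) + cdot y0 (F *v (v - x0))"
    by (simp add: cdot_diff_left cdot_diff_right matrix_vector_mult_diff_distrib)
  also have "cmod \<dots> \<le> norm (y - y0) * (norm F * norm v) + norm y0 * (norm F * norm (v - x0))"
    by (intro norm_triangle_mono order_trans[OF norm_cdot_le] mult_left_mono
        norm_matrix_vector_le) auto
  finally show ?thesis
    by (simp add: algebra_simps)
qed

lemma cdot_diff_le: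
  "cmod (cdot y v - cdot y0 x0) \<le> norm (y - y0) * norm v + norm y0 * norm (v - x0)"
proof -
  have "cdot y v - cdot y0 x0 = cdot (y - y0) v + cdot y0 (v - x0)"
    by (simp add: cdot_diff_left cdot_diff_right)
  also have "cmod \<dots> \<le> norm (y - y0) * norm v + norm y0 * norm (v - x0)"
    by (intro norm_triangle_mono norm_cdot_le)
  finally show ?thesis .
qed

lemma cdot_left_eigenvector:
  assumes "cvec_conj y v* F = \<mu> *s cvec_conj y"
  shows "cdot y (F *v w) = \<mu> * cdot y w"
proof -
  have "cdot y (F *v w) = (\<Sum>i\<in>UNIV. \<Sum>j\<in>UNIV. cnj (y $ i) * F $ i $ j * w $ j)"
    by (simp add: cdot_def matrix_vector_mult_def sum_distrib_left mult_ac)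
  also have "\<dots> = (\<Sum>j\<in>UNIV. (cvec_conj y v* F) $ j * w $ j)"
    by (subst sum.swap) (simp add: vector_matrix_mult_def cvec_conj_def sum_distrib_left mult_ac)
  also have "\<dots> = \<mu> * cdot y w"
    unfolding assms by (simp add: cdot_def cvec_conj_def sum_distrib_left mult_ac)
  finally show ?thesis .
qed

section \<open>Continuity of eigenvalues\<close>

lemma eigenvalues_iff_det: "\<mu> \<in> eigenvalues F \<longleftrightarrow> det (mat \<mu> - F) = 0"
proof -
  have mat: "(mat \<mu> - F) *v v = \<mu> *s v - F *v v" for v
    by (simp add: vec_eq_iff mat_def matrix_vector_mult_def left_diff_distrib sum_subtractf
        if_distrib[of "\<lambda>z. z * _"] cong: if_cong)
  have "det (mat \<mu> - F) \<noteq> 0 \<longleftrightarrow> (\<forall>v. (mat \<mu> - F) *v v = 0 \<longrightarrow> v = 0)"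
    by (metis invertible_det_nz invertible_left_inverse matrix_left_invertible_ker)
  then show ?thesis
    unfolding eigenvalues_def mat by (auto simp: right_minus_eq)
qed

text \<open>
  In the Leibniz expansion every permutation other than the identity meets a constant off-diagonal
  entry, so only the diagonal product reaches degree \<open>n\<close>.
\<close>
lemma degree_lead_coeff_charpoly:
  fixes F :: "complex ^ 'n ^ 'n"
  shows "degree (charpoly F) = CARD('n) \<and> lead_coeff (charpoly F) = 1"
proof -
  define M where "M = mat [:0, 1:] - map_matrix (\<lambda>z. [:z:]) F"
  define d where "d = (\<Prod>i\<in>(UNIV::'n set). M $ i $ i)"
  define t where "t p = of_int (sign p) * (\<Prod>i\<in>UNIV. M $ i $ p i)" for p
  define P where "P = {p. p permutes (UNIV::'n set)} - {id}"
  have fin: "finite {p. p permutes (UNIV::'n set)}"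
    by (rule finite_permutations) simp
  have Mii: "M $ i $ i = [:- F $ i $ i, 1:]" for i
    by (simp add: M_def mat_def)
  have Mij: "degree (M $ i $ j) = 0" if "i \<noteq> j" for i j
    using that by (simp add: M_def mat_def)
  have deg_d: "degree d = CARD('n)"
    unfolding d_def by (simp add: degree_prod_eq_sum_degree Mii)
  have lead_d: "lead_coeff d = 1"
    unfolding d_def lead_coeff_prod by (simp add: Mii)
  have small: "degree (t p) < CARD('n)" if "p \<in> P" for p
  proof -
    from that have "p \<noteq> id"
      by (simp add: P_def)
    then obtain k where k: "p k \<noteq> k"
      by (metis ext id_apply)
    have "degree (t p) \<le> degree (of_int (sign p) :: complex poly) + degree (\<Prod>i\<in>UNIV. M $ i $ p i)"
      unfolding t_def by (rule degree_mult_le)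
    also have "\<dots> \<le> (\<Sum>i\<in>UNIV. degree (M $ i $ p i))"
      using degree_prod_sum_le[of UNIV "\<lambda>i. M $ i $ p i"] by (simp add: o_def)
    also have "\<dots> < (\<Sum>i\<in>(UNIV::'n set). 1)"
    proof (rule sum_strict_mono_ex1)
      show "\<forall>i\<in>UNIV. degree (M $ i $ p i) \<le> 1"
        using Mij Mii by (metis degree_pCons_eq_if le_refl one_neq_zero pCons_eq_0_iff zero_le_one One_nat_def degree_pCons_0)
      show "\<exists>i\<in>UNIV. degree (M $ i $ p i) < 1"
        using Mij[of k "p k"] k by (intro bexI[of _ k]) auto
    qed auto
    finally show ?thesis
      by simp
  qed
  have "charpoly F = (\<Sum>p | p permutes UNIV. t p)"
    by (simp add: charpoly_def det_def M_def t_def)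
  also have "\<dots> = t id + sum t P"
    unfolding P_def by (rule sum.remove[OF fin]) (simp add: permutes_id)
  also have "t id = d"
    by (simp add: t_def d_def sign_id)
  finally have eq: "charpoly F = d + sum t P" .
  have "degree (sum t P) < degree d"
    unfolding deg_d
    by (rule degree_sum_less) (use small in auto)
  then show ?thesis
    unfolding eq using deg_d lead_d
    by (simp add: degree_add_eq_left coeff_eq_0)
qed

lemma charpoly_nonzero: "charpoly F \<noteq> 0"
  using degree_lead_coeff_charpoly[of F] by auto

lemma eigenvalues_eq_roots: "eigenvalues F = {\<mu>. poly (charpoly F) \<mu> = 0}"
  by (simp add: poly_charpoly eigenvalues_iff_det set_eq_iff)

lemma finite_eigenvalues: "finite (eigenvalues F)"
  unfolding eigenvalues_eq_roots by (rule poly_roots_finite[OF charpoly_nonzero])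

lemma eigenvalues_nonempty:
  fixes F :: "complex ^ 'n ^ 'n"
  shows "eigenvalues F \<noteq> {}"
proof -
  have "\<not> constant (poly (charpoly F))"
    using degree_lead_coeff_charpoly[of F] constant_degree[of "charpoly F"] by simp
  then show ?thesis
    unfolding eigenvalues_eq_roots using fundamental_theorem_of_algebra by blast
qed

lemma card_eigenvalues_le:
  fixes F :: "complex ^ 'n ^ 'n"
  shows "card (eigenvalues F) \<le> CARD('n)"
  unfolding eigenvalues_eq_roots
  using card_poly_roots_bound[OF charpoly_nonzero[of F]] degree_lead_coeff_charpoly[of F] by simp

text \<open>
  The multiplicities of the roots add up to the degree \<open>n\<close>.
\<close>
lemma card_eigenvalues_simple:
  fixes F :: "complex ^ 'n ^ 'n"
  assumes "\<And>\<mu>. \<mu> \<in> eigenvalues F \<Longrightarrow> simple_eigenvalue F \<mu>"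
  shows "card (eigenvalues F) = CARD('n)"
proof -
  have "CARD('n) = size (proots (charpoly F))"
    using degree_lead_coeff_charpoly[of F] by (simp add: size_proots_complex)
  also have "\<dots> = (\<Sum>\<mu>\<in>eigenvalues F. order \<mu> (charpoly F))"
    using charpoly_nonzero[of F]
    by (simp add: size_multiset_overloaded_eq eigenvalues_eq_roots count_proots set_count_proots)
  also have "\<dots> = card (eigenvalues F)"
    using assms by (simp add: simple_eigenvalue_def)
  finally show ?thesis ..
qed

text \<open>
  A monic polynomial is the product of the factors \<open>z - \<nu>\<close> over its roots \<open>\<nu>\<close>, counted with
  multiplicity.
\<close>
lemma det_lower_bound:
  fixes F :: "complex ^ 'n ^ 'n"
  assumes "0 \<le> e" "\<And>\<nu>. \<nu> \<in> eigenvalues F \<Longrightarrow> e \<le> dist \<nu> z"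
  shows "e ^ CARD('n) \<le> cmod (det (mat z - F))"
proof -
  have pow: "e ^ size M \<le> cmod (poly (\<Prod>a\<in>#M. [:-a, 1:]) z)"
    if "\<And>a. a \<in># M \<Longrightarrow> e \<le> dist a z" for M
    using that
  proof (induction M)
    case (add a M)
    then have "e * e ^ size M \<le> dist a z * cmod (poly (\<Prod>a\<in>#M. [:-a, 1:]) z)"
      using assms(1) by (intro mult_mono) auto
    also have "\<dots> = cmod ((z - a) * poly (\<Prod>a\<in>#M. [:-a, 1:]) z)"
      by (simp add: dist_norm norm_mult norm_minus_commute)
    finally show ?case
      by (simp add: algebra_simps)
  qed simp
  have roots: "set_mset (proots (charpoly F)) = eigenvalues F"
    using charpoly_nonzero[of F] by (simp add: eigenvalues_eq_roots set_count_proots)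
  have "size (proots (charpoly F)) = CARD('n)"
    using degree_lead_coeff_charpoly[of F] by (simp add: size_proots_complex)
  moreover have "(\<Prod>a\<in>#proots (charpoly F). [:-a, 1:]) = charpoly F"
    using complex_poly_decompose_multiset[of "charpoly F"] degree_lead_coeff_charpoly[of F]
    by (metis smult_1_left)
  ultimately show ?thesis
    using pow[of "proots (charpoly F)"] assms(2) by (simp add: roots poly_charpoly)
qed

lemma continuous_on_det [continuous_intros]:
  fixes f :: "'a::topological_space \<Rightarrow> complex ^ 'n ^ 'n"
  assumes "continuous_on S f"
  shows "continuous_on S (\<lambda>x. det (f x))"
  unfolding det_def by (intro continuous_intros assms)

text \<open>
  The characteristic polynomial of a nearby matrix is small at \<open>\<mu>\<close>, and by \<open>det_lower_bound\<close> this forces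
  one of its roots to be close to \<open>\<mu>\<close>.
\<close>
lemma eigenvalue_persistence:
  fixes F :: "complex ^ 'n ^ 'n"
  assumes "\<mu> \<in> eigenvalues F" "e > 0"
  shows "\<exists>d>0. \<forall>G. dist G F < d \<longrightarrow> (\<exists>\<nu>\<in>eigenvalues G. dist \<nu> \<mu> < e)"
proof -
  have "continuous_on UNIV (\<lambda>G. det (mat \<mu> - G :: complex ^ 'n ^ 'n))"
    by (intro continuous_intros)
  moreover have "e ^ CARD('n) > 0"
    using assms by simp
  ultimately obtain d where d: "d > 0"
    "\<And>G. dist G F < d \<Longrightarrow> dist (det (mat \<mu> - G)) (det (mat \<mu> - F)) < e ^ CARD('n)"
    by (meson UNIV_I continuous_on_iff)
  have "\<exists>\<nu>\<in>eigenvalues G. dist \<nu> \<mu> < e" if "dist G F < d" for G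
  proof (rule ccontr)
    assume "\<not> ?thesis"
    then have "e ^ CARD('n) \<le> cmod (det (mat \<mu> - G))"
      using assms by (intro det_lower_bound) auto
    then show False
      using d(2)[OF that] assms by (simp add: eigenvalues_iff_det)
  qed
  with d show ?thesis
    by blast
qed

text \<open>
  The eigenvalue that persists near \<open>m F\<close> lies in the open set \<open>B\<close>, where \<open>m G\<close> is the only one.
\<close>
lemma continuous_on_isolated_eigenvalue:
  assumes "open B" "\<And>G. G \<in> S \<Longrightarrow> eigenvalues G \<inter> B = {m G}"
  shows "continuous_on S m"
proof (unfold continuous_on_iff, intro ballI allI impI)
  fix F and e :: real
  assume F: "F \<in> S" and e: "e > 0"
  have mF: "m F \<in> eigenvalues F" "m F \<in> B"
    using assms(2)[OF F] by auto
  obtain \<rho> where \<rho>: "\<rho> > 0" "ball (m F) \<rho> \<subseteq> B"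
    using assms(1) mF(2) openE by blast
  obtain d where d: "d > 0" "\<And>G. dist G F < d \<Longrightarrow> \<exists>\<nu>\<in>eigenvalues G. dist \<nu> (m F) < min e \<rho>"
    using eigenvalue_persistence[OF mF(1), of "min e \<rho>"] e \<rho>(1) by auto
  have "dist (m G) (m F) < e" if G: "G \<in> S" "dist G F < d" for G
  proof -
    obtain \<nu> where \<nu>: "\<nu> \<in> eigenvalues G" "dist \<nu> (m F) < e" "dist \<nu> (m F) < \<rho>"
      using d(2)[OF G(2)] by auto
    then have "\<nu> \<in> B"
      using \<rho>(2) by (auto simp: dist_commute)
    with \<nu> assms(2)[OF G(1)] show ?thesis
      by (metis IntI singletonD)
  qed
  with d(1) show "\<exists>d>0. \<forall>G\<in>S. dist G F < d \<longrightarrow> dist (m G) (m F) < e"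
    by blast
qed

section \<open>The eigenvalue branches and the pseudospectral abscissa\<close>

lemma eventually_at_right_0:
  assumes "(b::real) > 0"
  shows "\<forall>\<^sub>F \<epsilon> in at_right 0. 0 < \<epsilon> \<and> \<epsilon> < b"
  using eventually_at_right_real[OF assms] by (simp add: greaterThanLessThan_iff)

locale isolated_eigenvalues =
  fixes A :: "complex ^ 'n ^ 'n"
    and U :: "real set"
    and r :: "complex \<Rightarrow> real"
  assumes U: "open U" "is_interval U" "0 \<in> U"
    and r_pos: "\<And>\<mu>0. \<mu>0 \<in> eigenvalues A \<Longrightarrow> r \<mu>0 > 0"
    and only_one: "\<And>\<mu>0 \<eta> \<Delta>. \<mu>0 \<in> eigenvalues A \<Longrightarrow> \<eta> \<in> U \<Longrightarrow> norm \<Delta> \<le> 1 \<Longrightarrow>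
          \<exists>\<mu>. eigenvalues (A + \<eta> *\<^sub>R \<Delta>) \<inter> ball \<mu>0 (r \<mu>0) = {\<mu>} \<and>
              simple_eigenvalue (A + \<eta> *\<^sub>R \<Delta>) \<mu>"
begin

abbreviation eig :: "real \<Rightarrow> complex ^ 'n ^ 'n \<Rightarrow> complex \<Rightarrow> complex" where
  "eig \<equiv> pert_eigenvalue A r"

lemma eventually_in_U: "\<forall>\<^sub>F \<epsilon> in at_right 0. {0..\<epsilon>} \<subseteq> U"
proof -
  obtain d where d: "d > 0" "ball 0 d \<subseteq> U"
    using U openE by blast
  have "{0..\<epsilon>} \<subseteq> ball 0 d" if "0 < \<epsilon> \<and> \<epsilon> < d" for \<epsilon>
    using that by auto
  then have "{0..\<epsilon>} \<subseteq> U" if "0 < \<epsilon> \<and> \<epsilon> < d" for \<epsilon>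
    using d(2) that by (meson order_trans)
  then show ?thesis
    by (rule eventually_mono[OF eventually_at_right_0[OF d(1)]])
qed

lemma eigenvalues_Int_ball:
  assumes "\<mu>0 \<in> eigenvalues A" "\<eta> \<in> U" "norm \<Delta> \<le> 1"
  shows "eigenvalues (A + \<eta> *\<^sub>R \<Delta>) \<inter> ball \<mu>0 (r \<mu>0) = {eig \<eta> \<Delta> \<mu>0}"
proof -
  obtain \<mu> where \<mu>: "eigenvalues (A + \<eta> *\<^sub>R \<Delta>) \<inter> ball \<mu>0 (r \<mu>0) = {\<mu>}"
    using only_one[OF assms] by blast
  then have "eig \<eta> \<Delta> \<mu>0 = \<mu>"
    unfolding pert_eigenvalue_def by simp
  with \<mu> show ?thesis
    by simp
qed

lemma eig_mem:
  assumes "\<mu>0 \<in> eigenvalues A" "\<eta> \<in> U" "norm \<Delta> \<le> 1"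
  shows "eig \<eta> \<Delta> \<mu>0 \<in> eigenvalues (A + \<eta> *\<^sub>R \<Delta>)"
  using eigenvalues_Int_ball[OF assms] by blast

lemma eig_unique:
  assumes "\<mu>0 \<in> eigenvalues A" "\<eta> \<in> U" "norm \<Delta> \<le> 1"
    and "\<mu> \<in> eigenvalues (A + \<eta> *\<^sub>R \<Delta>)" "dist \<mu> \<mu>0 < r \<mu>0"
  shows "\<mu> = eig \<eta> \<Delta> \<mu>0"
proof -
  have "\<mu> \<in> eigenvalues (A + \<eta> *\<^sub>R \<Delta>) \<inter> ball \<mu>0 (r \<mu>0)"
    using assms(4,5) by (simp add: dist_commute)
  then show ?thesis
    unfolding eigenvalues_Int_ball[OF assms(1-3)] by simp
qed

lemma eig_0:
  assumes "\<mu>0 \<in> eigenvalues A" "norm \<Delta> \<le> 1"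
  shows "eig 0 \<Delta> \<mu>0 = \<mu>0"
  using eig_unique[OF assms(1) U(3) assms(2), of \<mu>0] assms(1) r_pos by simp

lemma continuous_on_eig:
  assumes "\<mu>0 \<in> eigenvalues A"
    and "continuous_on S f" "continuous_on S g"
    and "\<And>s. s \<in> S \<Longrightarrow> f s \<in> U" "\<And>s. s \<in> S \<Longrightarrow> norm (g s) \<le> 1"
  shows "continuous_on S (\<lambda>s. eig (f s) (g s) \<mu>0)"
proof -
  define m where "m G = (THE \<mu>. \<mu> \<in> eigenvalues G \<inter> ball \<mu>0 (r \<mu>0))"
    for G :: "complex ^ 'n ^ 'n"
  define G where "G s = A + f s *\<^sub>R g s" for s
  have "eigenvalues F \<inter> ball \<mu>0 (r \<mu>0) = {m F}" if "F \<in> G ` S" for F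
    using eigenvalues_Int_ball[OF assms(1)] assms(4,5) that
    by (auto simp: m_def G_def pert_eigenvalue_def)
  then have "continuous_on (G ` S) m"
    by (rule continuous_on_isolated_eigenvalue[OF open_ball])
  moreover have "continuous_on S G"
    unfolding G_def by (intro continuous_intros assms)
  ultimately have "continuous_on S (\<lambda>s. m (G s))"
    by (auto intro: continuous_on_compose2)
  then show ?thesis
    by (simp add: m_def G_def pert_eigenvalue_def)
qed

text \<open>
  The set \<open>E\<close> of parameters at which both branches agree is closed by continuity. It is also open,
  because the branches agree exactly when the first one enters the disk of the second one. As \<open>U\<close> is
  connected, a single coincidence would extend to \<open>\<eta> = 0\<close>.
\<close>
lemma eig_distinct:
  assumes \<mu>0: "\<mu>0 \<in> eigenvalues A" and \<mu>1: "\<mu>1 \<in> eigenvalues A"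
    and \<eta>: "\<eta> \<in> U" and \<Delta>: "norm \<Delta> \<le> 1"
    and eq: "eig \<eta> \<Delta> \<mu>0 = eig \<eta> \<Delta> \<mu>1"
  shows "\<mu>0 = \<mu>1"
proof -
  define f where "f s = eig s \<Delta> \<mu>0" for s
  define g where "g s = eig s \<Delta> \<mu>1" for s
  have cont: "continuous_on U f" "continuous_on U g"
    unfolding f_def g_def using \<Delta> by (auto intro!: continuous_on_eig \<mu>0 \<mu>1 continuous_intros)
  define E where "E = {s \<in> U. f s = g s}"
  have "E = {s \<in> U. f s - g s = 0}"
    by (auto simp: E_def)
  then have closed: "closedin (top_of_set U) E"
    using continuous_closedin_preimage_constant[of U "\<lambda>s. f s - g s" 0] cont
    by (simp add: continuous_on_diff)
  \<comment> \<open>the first branch in the disk of the second one is the unique eigenvalue there\<close>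
  have "E = U \<inter> f -` ball \<mu>1 (r \<mu>1)"
  proof (rule set_eqI)
    fix s
    have "f s = g s \<longleftrightarrow> f s \<in> ball \<mu>1 (r \<mu>1)" if "s \<in> U"
      using eigenvalues_Int_ball[OF \<mu>0 that \<Delta>] eigenvalues_Int_ball[OF \<mu>1 that \<Delta>]
      unfolding f_def g_def by blast
    then show "s \<in> E \<longleftrightarrow> s \<in> U \<inter> f -` ball \<mu>1 (r \<mu>1)"
      by (auto simp: E_def)
  qed
  then have "openin (top_of_set U) E"
    using continuous_openin_preimage_gen[OF cont(1) open_ball] by simp
  moreover have "E \<noteq> {}"
    using \<eta> eq by (auto simp: E_def f_def g_def)
  moreover have "connected U"
    using U(2) is_interval_connected by blast
  ultimately have "E = U"
    using closed connected_clopen by blast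
  then have "f 0 = g 0"
    using U(3) by (auto simp: E_def)
  then show ?thesis
    by (simp add: f_def g_def eig_0 \<mu>0 \<mu>1 \<Delta>)
qed

text \<open>
  The branches are \<open>n\<close> distinct eigenvalues, and a matrix has no more than \<open>n\<close>.
\<close>
lemma eigenvalues_perturbed:
  assumes \<eta>: "\<eta> \<in> U" and \<Delta>: "norm \<Delta> \<le> 1"
  shows "eigenvalues (A + \<eta> *\<^sub>R \<Delta>) = eig \<eta> \<Delta> ` eigenvalues A"
proof (rule sym, rule card_subset_eq[OF finite_eigenvalues])
  show sub: "eig \<eta> \<Delta> ` eigenvalues A \<subseteq> eigenvalues (A + \<eta> *\<^sub>R \<Delta>)"
    using eig_mem \<eta> \<Delta> by blast
  have simple: "simple_eigenvalue A \<mu>0" if "\<mu>0 \<in> eigenvalues A" for \<mu>0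
  proof -
    have "{\<mu>0} = eigenvalues A \<inter> ball \<mu>0 (r \<mu>0)"
      using eigenvalues_Int_ball[OF that U(3), of 0] eig_0[OF that, of 0] by simp
    then show ?thesis
      using only_one[OF that U(3), of 0] by auto
  qed
  have "inj_on (eig \<eta> \<Delta>) (eigenvalues A)"
    using eig_distinct \<eta> \<Delta> by (auto simp: inj_on_def)
  then have "card (eig \<eta> \<Delta> ` eigenvalues A) = CARD('n)"
    using card_eigenvalues_simple[OF simple] by (simp add: card_image)
  moreover have "card (eig \<eta> \<Delta> ` eigenvalues A) \<le> card (eigenvalues (A + \<eta> *\<^sub>R \<Delta>))"
    by (rule card_mono[OF finite_eigenvalues sub])
  ultimately show "card (eig \<eta> \<Delta> ` eigenvalues A) = card (eigenvalues (A + \<eta> *\<^sub>R \<Delta>))"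
    using card_eigenvalues_le[of "A + \<eta> *\<^sub>R \<Delta>"] by simp
qed

lemma max_Re_eigenvalue_attained:
  assumes "\<mu>0 \<in> eigenvalues A" "\<epsilon> \<in> U"
  shows "\<exists>\<Delta>. norm \<Delta> \<le> 1 \<and> max_Re_eigenvalue A r \<epsilon> \<mu>0 = Re (eig \<epsilon> \<Delta> \<mu>0)"
    and "norm \<Delta> \<le> 1 \<Longrightarrow> Re (eig \<epsilon> \<Delta> \<mu>0) \<le> max_Re_eigenvalue A r \<epsilon> \<mu>0"
proof -
  have "continuous_on (cball 0 1) (\<lambda>\<Delta>. Re (eig \<epsilon> \<Delta> \<mu>0))"
    using assms by (auto intro!: continuous_on_eig continuous_intros)
  then obtain \<Delta>1 where \<Delta>1: "norm \<Delta>1 \<le> 1"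
    "\<And>\<Delta>. norm \<Delta> \<le> 1 \<Longrightarrow> Re (eig \<epsilon> \<Delta> \<mu>0) \<le> Re (eig \<epsilon> \<Delta>1 \<mu>0)"
    using continuous_attains_sup[of "cball 0 1 :: (complex ^ 'n ^ 'n) set"
        "\<lambda>\<Delta>. Re (eig \<epsilon> \<Delta> \<mu>0)"] by auto
  have eq: "max_Re_eigenvalue A r \<epsilon> \<mu>0 = Re (eig \<epsilon> \<Delta>1 \<mu>0)"
    unfolding max_Re_eigenvalue_def by (rule Greatest_equality) (use \<Delta>1 in auto)
  show "\<exists>\<Delta>. norm \<Delta> \<le> 1 \<and> max_Re_eigenvalue A r \<epsilon> \<mu>0 = Re (eig \<epsilon> \<Delta> \<mu>0)"
    using \<Delta>1(1) eq by blast
  show "norm \<Delta> \<le> 1 \<Longrightarrow> Re (eig \<epsilon> \<Delta> \<mu>0) \<le> max_Re_eigenvalue A r \<epsilon> \<mu>0"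
    using \<Delta>1(2) eq by simp
qed

lemma pseudospectrum_eq:
  assumes "\<epsilon> > 0" "\<epsilon> \<in> U"
  shows "pseudospectrum \<epsilon> A = (\<Union>\<Delta>\<in>cball 0 1. eig \<epsilon> \<Delta> ` eigenvalues A)"
proof -
  have "{\<Delta>. norm \<Delta> \<le> \<epsilon>} = (\<lambda>\<Delta>. \<epsilon> *\<^sub>R \<Delta>) ` cball (0 :: complex ^ 'n ^ 'n) 1"
  proof (intro set_eqI iffI)
    fix \<Delta> :: "complex ^ 'n ^ 'n"
    assume "\<Delta> \<in> {\<Delta>. norm \<Delta> \<le> \<epsilon>}"
    then show "\<Delta> \<in> (\<lambda>\<Delta>. \<epsilon> *\<^sub>R \<Delta>) ` cball 0 1"
      using assms by (intro image_eqI[of _ _ "\<Delta> /\<^sub>R \<epsilon>"]) (auto simp: field_simps)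
  qed (use assms in \<open>auto simp: mult_left_le\<close>)
  then have "pseudospectrum \<epsilon> A = (\<Union>\<Delta>\<in>cball 0 1. eigenvalues (A + \<epsilon> *\<^sub>R \<Delta>))"
    by (simp add: pseudospectrum_def)
  also have "\<dots> = (\<Union>\<Delta>\<in>cball 0 1. eig \<epsilon> \<Delta> ` eigenvalues A)"
    using eigenvalues_perturbed[OF assms(2)] by simp
  finally show ?thesis .
qed

lemma pseudospectral_abscissa_eq_Max:
  assumes "\<epsilon> > 0" "\<epsilon> \<in> U"
  shows "pseudospectral_abscissa \<epsilon> A = (MAX \<mu>0\<in>eigenvalues A. max_Re_eigenvalue A r \<epsilon> \<mu>0)"
  unfolding pseudospectral_abscissa_def
proof (rule Greatest_equality)
  let ?M = "MAX \<mu>0\<in>eigenvalues A. max_Re_eigenvalue A r \<epsilon> \<mu>0"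
  have "?M \<in> max_Re_eigenvalue A r \<epsilon> ` eigenvalues A"
    by (intro Max_in) (auto simp: finite_eigenvalues eigenvalues_nonempty)
  then show "?M \<in> Re ` pseudospectrum \<epsilon> A"
    unfolding pseudospectrum_eq[OF assms]
    using max_Re_eigenvalue_attained(1)[OF _ assms(2)] by fastforce
next
  fix t
  assume "t \<in> Re ` pseudospectrum \<epsilon> A"
  then obtain \<Delta> \<mu>0 where \<Delta>: "norm \<Delta> \<le> 1" "\<mu>0 \<in> eigenvalues A" "t = Re (eig \<epsilon> \<Delta> \<mu>0)"
    unfolding pseudospectrum_eq[OF assms] by auto
  then have "t \<le> max_Re_eigenvalue A r \<epsilon> \<mu>0"
    using max_Re_eigenvalue_attained(2)[OF _ assms(2)] by simp
  also have "\<dots> \<le> (MAX \<mu>0\<in>eigenvalues A. max_Re_eigenvalue A r \<epsilon> \<mu>0)"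
    using \<Delta>(2) by (simp add: finite_eigenvalues)
  finally show "t \<le> (MAX \<mu>0\<in>eigenvalues A. max_Re_eigenvalue A r \<epsilon> \<mu>0)" .
qed

lemma Re_eig_le_spectral_abscissa:
  assumes "\<mu>0 \<in> eigenvalues A" "\<epsilon> \<in> U" "norm \<Delta> \<le> 1"
  shows "Re (eig \<epsilon> \<Delta> \<mu>0) \<le> spectral_abscissa (A + \<epsilon> *\<^sub>R \<Delta>)"
  unfolding spectral_abscissa_def using eig_mem[OF assms]
  by (intro Max_ge) (auto simp: finite_eigenvalues)

lemma spectral_abscissa_le_pseudospectral_abscissa:
  assumes "\<epsilon> > 0" "\<epsilon> \<in> U" "norm \<Delta> \<le> 1"
  shows "spectral_abscissa (A + \<epsilon> *\<^sub>R \<Delta>) \<le> pseudospectral_abscissa \<epsilon> A"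
proof -
  have "spectral_abscissa (A + \<epsilon> *\<^sub>R \<Delta>) \<in> Re ` eigenvalues (A + \<epsilon> *\<^sub>R \<Delta>)"
    unfolding spectral_abscissa_def
    by (intro Max_in) (simp_all add: finite_eigenvalues eigenvalues_nonempty)
  then obtain \<mu>0 where \<mu>0: "\<mu>0 \<in> eigenvalues A"
    "spectral_abscissa (A + \<epsilon> *\<^sub>R \<Delta>) = Re (eig \<epsilon> \<Delta> \<mu>0)"
    unfolding eigenvalues_perturbed[OF assms(2,3)] by auto
  have "Re (eig \<epsilon> \<Delta> \<mu>0) \<le> max_Re_eigenvalue A r \<epsilon> \<mu>0"
    by (rule max_Re_eigenvalue_attained(2)[OF \<mu>0(1) assms(2,3)])
  also have "\<dots> \<le> pseudospectral_abscissa \<epsilon> A"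
    unfolding pseudospectral_abscissa_eq_Max[OF assms(1,2)]
    using \<mu>0(1) by (simp add: finite_eigenvalues)
  finally show ?thesis
    unfolding \<mu>0(2) .
qed

end

section \<open>Perturbation of a simple eigenvector\<close>

locale isolated_eigentriple = isolated_eigenvalues A U r
  for A :: "complex ^ 'n ^ 'n" and U r +
  fixes \<mu>0 :: complex and x0 y0 :: "complex ^ 'n"
  assumes \<mu>0: "\<mu>0 \<in> eigenvalues A" and pair0: "unit_eigenpair A \<mu>0 x0 y0"
begin

definition "\<kappa> = Re (cdot y0 x0)"

definition "D = outer y0 x0"

lemma norm_x0 [simp]: "norm x0 = 1" and norm_y0 [simp]: "norm y0 = 1"
  and x0: "A *v x0 = \<mu>0 *s x0" and \<kappa>_pos: "\<kappa> > 0"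
  using pair0 by (simp_all add: unit_eigenpair_def \<kappa>_def)

lemma x0_nonzero: "x0 \<noteq> 0"
  using norm_x0 by fastforce

lemma cdot_y0_x0: "cdot y0 x0 = of_real \<kappa>"
  using pair0 by (simp add: unit_eigenpair_def \<kappa>_def)

lemma y0: "cdot y0 (A *v w) = \<mu>0 * cdot y0 w"
  using pair0 by (simp add: unit_eigenpair_def cdot_left_eigenvector)

lemma norm_D [simp]: "norm D = 1"
  by (simp add: D_def norm_outer)

text \<open>
  An eigenvector \<open>w\<close> of \<open>\<mu>0\<close> that is annihilated by \<open>y0\<close> is not moved by the perturbation \<open>x0 y0\<^sup>*\<close>, while
  \<open>x0\<close> gets the eigenvalue \<open>\<mu>0 + \<eta> \<kappa>\<close>. Both eigenvalues lie in the disk about \<open>\<mu>0\<close> for small \<open>\<eta> > 0\<close>,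
  which contradicts uniqueness.
\<close>
lemma eigenspace_transversal:
  assumes w: "A *v w = \<mu>0 *s w" "cdot y0 w = 0"
  shows "w = 0"
proof (rule ccontr)
  assume "w \<noteq> 0"
  define E where "E = outer x0 y0"
  have E: "norm E \<le> 1" "E *v x0 = of_real \<kappa> *s x0" "E *v w = 0"
    by (simp_all add: E_def norm_outer outer_vector cdot_y0_x0 w(2))
  have "\<forall>\<^sub>F \<epsilon> in at_right 0. {0..\<epsilon>} \<subseteq> U \<and> 0 < \<epsilon> \<and> \<epsilon> < r \<mu>0 / \<kappa>"
    using r_pos[OF \<mu>0] \<kappa>_pos by (intro eventually_conj eventually_in_U eventually_at_right_0) auto
  then obtain \<eta> where \<eta>: "{0..\<eta>} \<subseteq> U" "0 < \<eta>" "\<eta> < r \<mu>0 / \<kappa>"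
    using eventually_happens'[OF trivial_limit_at_right_real] by blast
  then have "\<eta> \<in> U"
    by auto
  note unique = eig_unique[OF \<mu>0 this E(1)]
  have "(A + \<eta> *\<^sub>R E) *v w = \<mu>0 *s w"
    by (simp add: matrix_vector_mult_add_rdistrib scaleR_matrix_vector w E)
  then have "\<mu>0 \<in> eigenvalues (A + \<eta> *\<^sub>R E)"
    using \<open>w \<noteq> 0\<close> by (auto simp: eigenvalues_def)
  moreover have "(A + \<eta> *\<^sub>R E) *v x0 = (\<mu>0 + of_real (\<eta> * \<kappa>)) *s x0"
    by (simp add: matrix_vector_mult_add_rdistrib scaleR_matrix_vector x0 E vec_eq_iff
        scaleR_conv_of_real[where 'a=complex] algebra_simps)
  then have "\<mu>0 + of_real (\<eta> * \<kappa>) \<in> eigenvalues (A + \<eta> *\<^sub>R E)"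
    unfolding eigenvalues_def using x0_nonzero by blast
  moreover have "cmod (of_real (\<eta> * \<kappa>)) < r \<mu>0"
    using \<eta> \<kappa>_pos by (simp add: norm_mult field_simps)
  ultimately have "\<mu>0 + of_real (\<eta> * \<kappa>) = eig \<eta> E \<mu>0" and "\<mu>0 = eig \<eta> E \<mu>0"
    using unique[of "\<mu>0 + of_real (\<eta> * \<kappa>)"] unique[of \<mu>0] r_pos[OF \<mu>0]
    by (auto simp: dist_norm)
  then have "of_real (\<eta> * \<kappa>) = (0 :: complex)"
    by (metis add_cancel_left_right)
  then show False
    using \<eta> \<kappa>_pos by simp
qed

text \<open>
  The map \<open>A - \<mu>0\<close> is injective on the hyperplane orthogonal to \<open>y0\<close>, hence bounded below there by
  finite dimension.
\<close>
lemma transversal_lower_bound: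
  obtains c where "c > 0" "\<And>w. cdot y0 w = 0 \<Longrightarrow> c * norm w \<le> norm (A *v w - \<mu>0 *s w)"
proof -
  define S where "S = {w. cdot y0 w = 0}"
  define f where "f w = A *v w - \<mu>0 *s w" for w
  have sub: "subspace S"
    by (auto simp: S_def subspace_def cdot_add_right cdot_scaleR_right)
  have "linear f"
    by (rule linearI) (auto simp: f_def vec_eq_iff matrix_vector_right_distrib algebra_simps
        matrix_vector_mult_def sum.distrib scaleR_sum_right)
  then have "bounded_linear f"
    by (simp add: linear_conv_bounded_linear)
  then obtain c where "c > 0" "\<forall>w\<in>S. c * norm w \<le> norm (f w)"
    using injective_imp_isometric[OF closed_subspace[OF sub] sub, of f] eigenspace_transversal
    by (auto simp: f_def S_def)
  with that show ?thesis
    by (auto simp: f_def S_def)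
qed

text \<open>
  A unit eigenvector \<open>v\<close> of \<open>A + \<epsilon>\<Delta>\<close> splits as \<open>s x0 + w\<close> with \<open>w\<close> orthogonal to \<open>y0\<close>. The lower bound for
  \<open>A - \<mu>0\<close> controls \<open>w\<close> by \<open>\<bar>\<mu> - \<mu>0\<bar> + \<epsilon>\<close>. Continuity of the eigenvalue first makes this small enough
  for \<open>\<bar>s\<bar> \<ge> 1/2\<close>; pairing with \<open>y0\<close> then gives \<open>\<mu> - \<mu>0 = O(\<epsilon>)\<close>, and \<open>v / s\<close> is as close to
  \<open>x0\<close> as claimed. The constant does not depend on \<open>\<Delta>\<close>.
\<close>
lemma eigenvector_perturbation:
  obtains C where "C \<ge> 0" "\<forall>\<^sub>F \<epsilon> in at_right 0. \<forall>\<Delta>. norm \<Delta> \<le> 1 \<longrightarrow>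
    (\<exists>v. (A + \<epsilon> *\<^sub>R \<Delta>) *v v = eig \<epsilon> \<Delta> \<mu>0 *s v \<and> norm (v - x0) \<le> C * \<epsilon>)"
proof -
  obtain c where c: "c > 0" "\<And>w. cdot y0 w = 0 \<Longrightarrow> c * norm w \<le> norm (A *v w - \<mu>0 *s w)"
    using transversal_lower_bound by blast
  define C where "C = 2 * (2 / \<kappa> + 1) / c"
  \<comment> \<open>the radius \<open>c / 4\<close>, together with \<open>\<epsilon> < c / 4\<close>, will give \<open>norm w \<le> 1 / 2\<close>\<close>
  obtain d where d: "d > 0"
    "\<And>G. dist G A < d \<Longrightarrow> \<exists>\<nu>\<in>eigenvalues G. dist \<nu> \<mu>0 < min (r \<mu>0) (c / 4)"
    using eigenvalue_persistence[OF \<mu>0, of "min (r \<mu>0) (c / 4)"] r_pos[OF \<mu>0] c(1) by auto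
  have "\<exists>v. (A + \<epsilon> *\<^sub>R \<Delta>) *v v = eig \<epsilon> \<Delta> \<mu>0 *s v \<and> norm (v - x0) \<le> C * \<epsilon>"
    if \<epsilon>: "{0..\<epsilon>} \<subseteq> U" "0 < \<epsilon>" "\<epsilon> < min d (c / 4)" and \<Delta>: "norm \<Delta> \<le> 1" for \<epsilon> \<Delta>
  proof -
    have "\<epsilon> \<in> U"
      using \<epsilon> by auto
    define \<mu> where "\<mu> = eig \<epsilon> \<Delta> \<mu>0"
    have \<epsilon>\<Delta>: "norm (\<epsilon> *\<^sub>R \<Delta>) \<le> \<epsilon>"
      using \<epsilon> \<Delta> by (simp add: mult_left_le)
    then have "dist (A + \<epsilon> *\<^sub>R \<Delta>) A < d"
      using \<epsilon> by (simp add: dist_norm del: norm_scaleR)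
    then have near: "cmod (\<mu> - \<mu>0) < c / 4"
      using d(2) eig_unique[OF \<mu>0 \<open>\<epsilon> \<in> U\<close> \<Delta>] by (fastforce simp: \<mu>_def dist_norm)
    obtain u where u: "u \<noteq> 0" "(A + \<epsilon> *\<^sub>R \<Delta>) *v u = \<mu> *s u"
      using eig_mem[OF \<mu>0 \<open>\<epsilon> \<in> U\<close> \<Delta>] by (auto simp: eigenvalues_def \<mu>_def)
    define v where "v = u /\<^sub>R norm u"
    have norm_v: "norm v = 1"
      using u by (simp add: v_def)
    have v: "(A + \<epsilon> *\<^sub>R \<Delta>) *v v = \<mu> *s v"
      using u(2) by (simp add: v_def matrix_vector_scaleR) (simp add: vec_eq_iff)
    define s where "s = cdot y0 v / of_real \<kappa>"
    define w where "w = v - s *s x0"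
    have "cdot y0 w = 0"
      using \<kappa>_pos by (simp add: w_def cdot_diff_right cdot_scale_right cdot_y0_x0 s_def)
    then have "c * norm w \<le> norm (A *v w - \<mu>0 *s w)"
      by (rule c(2))
    also have "A *v w - \<mu>0 *s w = A *v v - \<mu>0 *s v"
      by (simp add: w_def matrix_vector_mult_diff_distrib vector_scalar_commute x0
          vec_eq_iff algebra_simps)
    also have "A *v v - \<mu>0 *s v = (\<mu> - \<mu>0) *s v - (\<epsilon> *\<^sub>R \<Delta>) *v v"
      using v by (simp add: matrix_vector_mult_add_rdistrib vec_eq_iff algebra_simps)
    also have "norm \<dots> \<le> cmod (\<mu> - \<mu>0) + \<epsilon>"
      using norm_triangle_ineq4[of "(\<mu> - \<mu>0) *s v" "(\<epsilon> *\<^sub>R \<Delta>) *v v"]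
        norm_matrix_vector_le[of "\<epsilon> *\<^sub>R \<Delta>" v] \<epsilon>\<Delta>
      unfolding norm_vector_scale norm_v mult_1_right by linarith
    finally have w_le: "c * norm w \<le> cmod (\<mu> - \<mu>0) + \<epsilon>" .
    also have "\<dots> \<le> c * (1 / 2)"
      using near \<epsilon> by simp
    finally have "norm w \<le> 1 / 2"
      using c(1) by simp
    then have s_ge: "1 / 2 \<le> cmod s"
      using norm_triangle_ineq2[of v w] norm_v by (simp add: w_def norm_vector_scale)
    have "(\<mu> - \<mu>0) * cdot y0 v = cdot y0 ((\<epsilon> *\<^sub>R \<Delta>) *v v)"
      using arg_cong[OF v, of "cdot y0"]
      by (simp add: matrix_vector_mult_add_rdistrib cdot_add_right y0 cdot_scale_right algebra_simps)
    then have "cmod (\<mu> - \<mu>0) * cmod (cdot y0 v) \<le> \<epsilon>"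
      using norm_cdot_le[of y0 "(\<epsilon> *\<^sub>R \<Delta>) *v v"] norm_matrix_vector_le[of "\<epsilon> *\<^sub>R \<Delta>" v] \<epsilon>\<Delta>
      by (simp add: norm_v norm_mult[symmetric] del: norm_scaleR)
    moreover have "cmod (cdot y0 v) = \<kappa> * cmod s"
      using \<kappa>_pos by (simp add: s_def norm_divide)
    ultimately have "cmod (\<mu> - \<mu>0) * (\<kappa> * cmod s) \<le> \<epsilon>"
      by simp
    moreover have "cmod (\<mu> - \<mu>0) * (\<kappa> * (1 / 2)) \<le> cmod (\<mu> - \<mu>0) * (\<kappa> * cmod s)"
      using s_ge \<kappa>_pos by (intro mult_left_mono) auto
    ultimately have "cmod (\<mu> - \<mu>0) * (\<kappa> * (1 / 2)) \<le> \<epsilon>"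
      by linarith
    then have "cmod (\<mu> - \<mu>0) \<le> 2 / \<kappa> * \<epsilon>"
      using \<kappa>_pos by (simp add: field_simps)
    with w_le have "c * norm w \<le> (2 / \<kappa> + 1) * \<epsilon>"
      by (simp add: algebra_simps)
    then have "norm w \<le> (2 / \<kappa> + 1) * \<epsilon> / c"
      using c(1) by (simp add: field_simps)
    then have "norm w / cmod s \<le> (2 / \<kappa> + 1) * \<epsilon> / c / (1 / 2)"
      using s_ge by (intro frac_le) (auto intro: order_trans[OF norm_ge_zero])
    also have "\<dots> = C * \<epsilon>"
      by (simp add: C_def)
    finally have close: "norm w / cmod s \<le> C * \<epsilon>" .
    have "s \<noteq> 0"
      using s_ge by auto
    have "norm ((1 / s) *s v - x0) = norm ((1 / s) *s w)"
      using \<open>s \<noteq> 0\<close> by (intro arg_cong[where f=norm]) (simp add: w_def vec_eq_iff field_simps)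
    also have "\<dots> \<le> C * \<epsilon>"
      using close by (simp add: norm_vector_scale norm_divide)
    finally have "norm ((1 / s) *s v - x0) \<le> C * \<epsilon>" .
    moreover have "(A + \<epsilon> *\<^sub>R \<Delta>) *v ((1 / s) *s v) = \<mu> *s ((1 / s) *s v)"
      by (simp add: vector_scalar_commute v)
    ultimately show ?thesis
      unfolding \<mu>_def by blast
  qed
  moreover have "\<forall>\<^sub>F \<epsilon> in at_right 0. {0..\<epsilon>} \<subseteq> U \<and> 0 < \<epsilon> \<and> \<epsilon> < min d (c / 4)"
    using d c by (intro eventually_conj eventually_in_U eventually_at_right_0) auto
  ultimately have "\<forall>\<^sub>F \<epsilon> in at_right 0. \<forall>\<Delta>. norm \<Delta> \<le> 1 \<longrightarrow>
      (\<exists>v. (A + \<epsilon> *\<^sub>R \<Delta>) *v v = eig \<epsilon> \<Delta> \<mu>0 *s v \<and> norm (v - x0) \<le> C * \<epsilon>)"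
    by (auto elim!: eventually_mono)
  moreover have "C \<ge> 0"
    using c(1) \<kappa>_pos by (simp add: C_def)
  ultimately show ?thesis
    using that by blast
qed

end

section \<open>Difference quotients of the analytic eigenvectors\<close>

text \<open>
  At \<open>\<rho>/2\<close> the terms of the power series are bounded, so on the interval of half that radius the
  tail from \<open>k = 2\<close> is dominated by a geometric series times \<open>s\<^sup>2\<close>.
\<close>
lemma real_analytic_Taylor:
  fixes f :: "real \<Rightarrow> 'a::banach"
  assumes "f real_analytic_on U" "0 \<in> U"
  obtains d K \<rho> where "\<rho> > 0" "K \<ge> 0"
    "\<forall>s. \<bar>s\<bar> < \<rho> \<longrightarrow> norm (f s - f 0 - s *\<^sub>R d) \<le> K * s\<^sup>2"
proof -
  obtain \<rho> c where \<rho>: "\<rho> > 0" and c: "\<And>s. \<bar>s\<bar> < \<rho> \<Longrightarrow> (\<lambda>k. s ^ k *\<^sub>R c k) sums f s"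
    using assms unfolding real_analytic_on_def by fastforce
  have "(\<lambda>k. (\<rho> / 2) ^ k *\<^sub>R c k) \<longlonglongrightarrow> 0"
    using c[of "\<rho> / 2"] \<rho> by (intro summable_LIMSEQ_zero) (auto intro: sums_summable)
  then have "Bseq (\<lambda>k. (\<rho> / 2) ^ k *\<^sub>R c k)"
    by (intro convergent_imp_Bseq convergentI)
  then obtain M where M: "M > 0" "\<And>k. norm ((\<rho> / 2) ^ k *\<^sub>R c k) \<le> M"
    by (elim BseqE) blast
  have "(\<lambda>k. 0 ^ k *\<^sub>R c k) sums (\<Sum>k\<in>{0}. 0 ^ k *\<^sub>R c k)"
    by (rule sums_finite) auto
  then have c0: "f 0 = c 0"
    using c[of 0] \<rho> by (auto dest: sums_unique2)
  have "norm (f s - f 0 - s *\<^sub>R c 1) \<le> 8 * M / \<rho>\<^sup>2 * s\<^sup>2" if s: "\<bar>s\<bar> < \<rho> / 4" for s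
  proof -
    \<comment> \<open>the ratio of \<open>\<bar>s\<bar>\<close> to the point \<open>\<rho>/2\<close> at which the terms are bounded by \<open>M\<close>\<close>
    define q where "q = 2 * \<bar>s\<bar> / \<rho>"
    have q: "0 \<le> q" "q \<le> 1 / 2"
      using s \<rho> by (auto simp: q_def field_simps)
    have "(\<lambda>k. s ^ (k + 2) *\<^sub>R c (k + 2)) sums (f s - (\<Sum>k<2. s ^ k *\<^sub>R c k))"
      using s by (intro sums_split_initial_segment c) auto
    moreover have "f s - (\<Sum>k<2. s ^ k *\<^sub>R c k) = f s - f 0 - s *\<^sub>R c 1"
      by (simp add: numeral_2_eq_2 c0)
    ultimately have "(\<lambda>k. s ^ (k + 2) *\<^sub>R c (k + 2)) sums (f s - f 0 - s *\<^sub>R c 1)"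
      by simp
    moreover have "(\<lambda>k. M * q\<^sup>2 * (1 / 2) ^ k) sums (M * q\<^sup>2 * 2)"
      using geometric_sums[of "1 / 2 :: real"] by (intro sums_mult) simp
    moreover have "norm (s ^ (k + 2) *\<^sub>R c (k + 2)) \<le> M * q\<^sup>2 * (1 / 2) ^ k" for k
    proof -
      have "norm (s ^ (k + 2) *\<^sub>R c (k + 2)) = q ^ (k + 2) * norm ((\<rho> / 2) ^ (k + 2) *\<^sub>R c (k + 2))"
        using \<rho> by (simp add: q_def abs_mult power_abs power_divide power_mult_distrib field_simps)
      also have "\<dots> \<le> q ^ (k + 2) * M"
        using q(1) by (intro mult_left_mono M(2)) simp
      also have "\<dots> \<le> (q\<^sup>2 * (1 / 2) ^ k) * M"
      proof (rule mult_right_mono)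
        have "q ^ k \<le> (1 / 2) ^ k"
          using q by (intro power_mono)
        then show "q ^ (k + 2) \<le> q\<^sup>2 * (1 / 2) ^ k"
          using mult_left_mono[of "q ^ k" "(1 / 2) ^ k" "q\<^sup>2"]
          by (simp add: power2_eq_square mult.assoc)
      qed (use M in simp)
      finally show ?thesis
        by (simp add: mult_ac)
    qed
    ultimately have "norm (f s - f 0 - s *\<^sub>R c 1) \<le> M * q\<^sup>2 * 2"
      by (rule norm_sums_le)
    also have "\<dots> = 8 * M / \<rho>\<^sup>2 * s\<^sup>2"
      by (simp add: q_def power_divide power_mult_distrib)
    finally show ?thesis .
  qed
  then show ?thesis
    using that[of "\<rho> / 4" "8 * M / \<rho>\<^sup>2" "c 1"] \<rho> M(1) by simp
qed

lemma difference_quotient_Lipschitz: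
  fixes f :: "real \<Rightarrow> 'a::banach"
  assumes "f real_analytic_on U" "0 \<in> U"
  obtains d K where "K \<ge> 0"
    "\<forall>\<^sub>F s in at_right 0. norm ((f s - f 0) /\<^sub>R s - d) \<le> K * s"
proof -
  obtain d K \<rho> where \<rho>: "\<rho> > 0" "K \<ge> 0"
    "\<forall>s. \<bar>s\<bar> < \<rho> \<longrightarrow> norm (f s - f 0 - s *\<^sub>R d) \<le> K * s\<^sup>2"
    by (rule real_analytic_Taylor[OF assms]) blast
  have "norm ((f s - f 0) /\<^sub>R s - d) \<le> K * s" if s: "0 < s \<and> s < \<rho>" for s
  proof -
    have "(f s - f 0) /\<^sub>R s - d = (f s - f 0 - s *\<^sub>R d) /\<^sub>R s"
      using s by (simp add: scaleR_diff_right[of _ "f s - f 0"])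
    then have "norm ((f s - f 0) /\<^sub>R s - d) = norm (f s - f 0 - s *\<^sub>R d) / s"
      using s by (simp only: norm_scaleR) (simp add: divide_inverse)
    also have "\<dots> \<le> K * s\<^sup>2 / s"
      using s \<rho> by (intro divide_right_mono) auto
    finally show ?thesis
      using s by (simp add: power2_eq_square)
  qed
  then have "\<forall>\<^sub>F s in at_right 0. norm ((f s - f 0) /\<^sub>R s - d) \<le> K * s"
    by (rule eventually_mono[OF eventually_at_right_0[OF \<rho>(1)]])
  then show ?thesis
    by (rule that[OF \<rho>(2)])
qed

locale analytic_eigentriple = isolated_eigentriple A U r \<mu>0 x0 y0
  for A :: "complex ^ 'n ^ 'n" and U r \<mu>0 x0 y0 +
  fixes X Y :: "real \<Rightarrow> complex ^ 'n"
  assumes X0: "X 0 = x0" and Y0: "Y 0 = y0"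
    and pair: "\<And>\<eta>. \<eta> \<in> U \<Longrightarrow>
      unit_eigenpair (A + \<eta> *\<^sub>R outer y0 x0) (pert_eigenvalue A r \<eta> (outer y0 x0) \<mu>0) (X \<eta>) (Y \<eta>)"
    and X_analytic: "X real_analytic_on U" and Y_analytic: "Y real_analytic_on U"
begin

definition "qX s = (X s - x0) /\<^sub>R s"

definition "qY s = (Y s - y0) /\<^sub>R s"

text \<open>
  With \<open>qX\<close> and \<open>qY\<close> as the finite-difference substitutes for the derivatives of the eigenvectors, \<open>\<beta> s\<close>
  approximates the logarithmic derivative at \<open>0\<close> of the reciprocal of \<open>Y\<^sup>* X\<close>.
\<close>
definition "\<beta> s = (- 1 / cdot y0 x0) * (cdot (qY s) x0 + cdot y0 (qX s))"

text \<open>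
  Up to \<open>O(s)\<close>, this is the derivative at \<open>0\<close> of \<open>\<kappa> Y X\<^sup>* / (Y\<^sup>* X)\<close>, a multiple of the gradient of the
  eigenvalue, along the line \<open>A + \<eta>D\<close>.
\<close>
definition "W s = outer (qY s) x0 + outer y0 (qX s) + cmat_scale (\<beta> s) D"

definition "ascent s \<epsilon> = D + (\<epsilon> / 2) *\<^sub>R W s"

lemma right_eigenvector: "\<eta> \<in> U \<Longrightarrow> (A + \<eta> *\<^sub>R D) *v X \<eta> = eig \<eta> D \<mu>0 *s X \<eta>"
  and left_eigenvector:
    "\<eta> \<in> U \<Longrightarrow> cdot (Y \<eta>) ((A + \<eta> *\<^sub>R D) *v w) = eig \<eta> D \<mu>0 * cdot (Y \<eta>) w"
  and norm_X: "\<eta> \<in> U \<Longrightarrow> norm (X \<eta>) = 1" and norm_Y: "\<eta> \<in> U \<Longrightarrow> norm (Y \<eta>) = 1"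
  using pair[of \<eta>] cdot_left_eigenvector[of "Y \<eta>" "A + \<eta> *\<^sub>R D" "eig \<eta> D \<mu>0" w]
  by (simp_all add: unit_eigenpair_def D_def)

lemma X_eq: "s \<noteq> 0 \<Longrightarrow> X s = x0 + s *\<^sub>R qX s" and Y_eq: "s \<noteq> 0 \<Longrightarrow> Y s = y0 + s *\<^sub>R qY s"
  by (simp_all add: qX_def qY_def)

lemma quotients_Lipschitz:
  obtains dx dy K where "K \<ge> 0"
    "\<forall>\<^sub>F s in at_right 0. norm (qX s - dx) \<le> K * s \<and> norm (qY s - dy) \<le> K * s"
proof -
  obtain dx K1 where 1: "K1 \<ge> 0" "\<forall>\<^sub>F s in at_right 0. norm (qX s - dx) \<le> K1 * s"
    using difference_quotient_Lipschitz[OF X_analytic U(3)] unfolding qX_def X0 .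
  obtain dy K2 where 2: "K2 \<ge> 0" "\<forall>\<^sub>F s in at_right 0. norm (qY s - dy) \<le> K2 * s"
    using difference_quotient_Lipschitz[OF Y_analytic U(3)] unfolding qY_def Y0 .
  have "\<forall>\<^sub>F s in at_right 0. norm (qX s - dx) \<le> max K1 K2 * s \<and> norm (qY s - dy) \<le> max K1 K2 * s"
    using 1(2) 2(2) eventually_at_right_less[of 0]
  proof eventually_elim
    case (elim s)
    then have "K1 * s \<le> max K1 K2 * s" "K2 * s \<le> max K1 K2 * s"
      by (auto intro: mult_right_mono)
    with elim show ?case
      by linarith
  qed
  with 1(1) show ?thesis
    by (intro that[of "max K1 K2" dx dy]) auto
qed

lemma quotients_bounded:
  obtains B where "B > 0" "\<forall>\<^sub>F s in at_right 0. norm (qX s) \<le> B \<and> norm (qY s) \<le> B"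
proof -
  obtain dx dy K where K: "K \<ge> 0"
    "\<forall>\<^sub>F s in at_right 0. norm (qX s - dx) \<le> K * s \<and> norm (qY s - dy) \<le> K * s"
    by (rule quotients_Lipschitz) blast
  define B where "B = norm dx + norm dy + K + 1"
  have "\<forall>\<^sub>F s in at_right 0. norm (qX s) \<le> B \<and> norm (qY s) \<le> B"
    using K(2) eventually_at_right_0[of 1, simplified]
  proof eventually_elim
    case (elim s)
    then have "K * s \<le> K"
      using K(1) by (simp add: mult_left_le)
    moreover have "norm (qX s - dx) \<le> K * s" "norm (qY s - dy) \<le> K * s"
      using elim by auto
    ultimately have "norm (qX s) \<le> B" "norm (qY s) \<le> B"
      using norm_triangle_sub[of "qX s" dx] norm_triangle_sub[of "qY s" dy]
        norm_ge_zero[of dx] norm_ge_zero[of dy] unfolding B_def by linarith+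
    then show ?case ..
  qed
  moreover have "B > 0"
    using K(1) by (simp add: B_def add_nonneg_pos)
  ultimately show ?thesis
    by (intro that[of B])
qed

end

section \<open>Near-maximality of the outer product direction\<close>

text \<open>
  The lower bound is the Cauchy-Schwarz inequality for \<open>d\<close> and \<open>d + w\<close>; the upper bound is
  \<open>2t \<le> t\<^sup>2 + 1\<close> for \<open>t = \<parallel>d + w\<parallel>\<close>.
\<close>
lemma norm_add_unit_bounds:
  fixes d w :: "'a::real_inner"
  assumes "norm d = 1"
  shows "1 + inner d w \<le> norm (d + w)" "norm (d + w) \<le> 1 + inner d w + (norm w)\<^sup>2 / 2"
proof -
  have dd: "inner d d = 1"
    using assms by (simp add: dot_square_norm)
  have "1 + inner d w = inner d (d + w)"
    by (simp add: inner_add_right dd)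
  also have "\<dots> \<le> norm (d + w)"
    using norm_cauchy_schwarz[of d "d + w"] assms by simp
  finally show "1 + inner d w \<le> norm (d + w)" .
  have "(norm (d + w))\<^sup>2 = 1 + 2 * inner d w + (norm w)\<^sup>2"
    by (simp add: power2_norm_eq_inner inner_add_left inner_add_right dd inner_commute)
  moreover have "2 * norm (d + w) \<le> (norm (d + w))\<^sup>2 + 1"
    using zero_le_power2[of "norm (d + w) - 1"] by (simp add: power2_diff)
  ultimately show "norm (d + w) \<le> 1 + inner d w + (norm w)\<^sup>2 / 2"
    by simp
qed

lemma norm_normalized_diff_le:
  assumes "norm d = 1" "m \<noteq> 0"
  shows "norm (m /\<^sub>R norm m - d) \<le> 2 * norm (m - d)"
proof -
  have "m /\<^sub>R norm m - m = (1 / norm m - 1) *\<^sub>R m"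
    by (simp add: scaleR_diff_left divide_inverse)
  moreover have "(1 / norm m - 1) * norm m = norm d - norm m"
    using assms by (simp add: left_diff_distrib)
  ultimately have "norm (m /\<^sub>R norm m - m) = \<bar>norm m - norm d\<bar>"
    by (metis abs_minus_commute abs_mult abs_norm_cancel norm_scaleR)
  also have "\<dots> \<le> norm (m - d)"
    by (rule norm_triangle_ineq3)
  finally have "norm (m /\<^sub>R norm m - m) \<le> norm (m - d)" .
  then show ?thesis
    using norm_triangle_ineq[of "m /\<^sub>R norm m - m" "m - d"] by simp
qed

lemma inner_unit_diff:
  fixes d e :: "'a::real_inner"
  assumes "norm d = 1"
  shows "inner d (e - d) = ((norm e)\<^sup>2 - 1 - (norm (e - d))\<^sup>2) / 2"
proof -
  have "inner d d = 1"
    using assms norm_eq_1 by blast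
  then show ?thesis
    unfolding power2_norm_eq_inner
    by (simp add: inner_diff_left inner_diff_right inner_commute[of e d])
qed

text \<open>
  A chord of the unit sphere is almost orthogonal to the radius.
\<close>
lemma unit_difference_quotient:
  fixes x q :: "'a::real_inner"
  assumes "norm x = 1" "norm (x + s *\<^sub>R q) = 1" "s > 0"
  shows "inner x q = - s * (norm q)\<^sup>2 / 2"
proof -
  have "s * (2 * inner x q + s * (norm q)\<^sup>2) = 0"
    using assms(1,2) unfolding norm_eq_1 power2_norm_eq_inner
    by (simp add: inner_add_left inner_add_right inner_commute[of q x] algebra_simps)
  then have "2 * inner x q + s * (norm q)\<^sup>2 = 0"
    using assms(3) by simp
  then show ?thesis
    by simp
qed

context analytic_eigentriple
begin

text \<open>
  For the left eigenvector \<open>Y \<epsilon>\<close> of \<open>A + \<epsilon>D\<close> and a right eigenvector \<open>v\<close> of \<open>A + \<epsilon>\<Delta>\<close>, the difference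
  of the eigenvalues times \<open>Y\<^sup>* v\<close> is exactly \<open>\<epsilon> Y\<^sup>* (\<Delta> - D) v\<close>. Both vectors are within \<open>O(\<epsilon>)\<close> of
  \<open>y0\<close> and \<open>x0\<close>, and replacing them costs a further factor \<open>\<epsilon>\<close> without losing the factor
  \<open>\<parallel>\<Delta> - D\<parallel>\<close>, which is what makes the estimate sharp enough near \<open>D\<close>.
\<close>
lemma eigenvalue_difference:
  obtains C where "C \<ge> 0" "\<forall>\<^sub>F \<epsilon> in at_right 0. \<forall>\<Delta>. norm \<Delta> \<le> 1 \<longrightarrow>
    \<bar>Re (eig \<epsilon> \<Delta> \<mu>0) - Re (eig \<epsilon> D \<mu>0) - \<epsilon> / \<kappa> * inner D (\<Delta> - D)\<bar> \<le> C * \<epsilon>\<^sup>2 * norm (\<Delta> - D)"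
proof -
  obtain C1 where C1: "C1 \<ge> 0" "\<forall>\<^sub>F \<epsilon> in at_right 0. \<forall>\<Delta>. norm \<Delta> \<le> 1 \<longrightarrow>
    (\<exists>v. (A + \<epsilon> *\<^sub>R \<Delta>) *v v = eig \<epsilon> \<Delta> \<mu>0 *s v \<and> norm (v - x0) \<le> C1 * \<epsilon>)"
    by (rule eigenvector_perturbation) blast
  obtain B where B: "B > 0" "\<forall>\<^sub>F s in at_right 0. norm (qX s) \<le> B \<and> norm (qY s) \<le> B"
    by (rule quotients_bounded) blast
  \<comment> \<open>\<open>C2 \<epsilon>\<close> bounds the effect of replacing \<open>Y \<epsilon>\<close> and \<open>v\<close> by \<open>y0\<close> and \<open>x0\<close> in a pairing\<close>
  define C2 where "C2 = B * (1 + C1) + C1"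
  have "C2 > 0"
    using B C1 by (auto simp: C2_def intro!: add_pos_nonneg mult_pos_pos)
  define C where "C = 2 * C2 / \<kappa> + 2 * C2 / \<kappa>\<^sup>2"
  have "\<kappa> / (2 * C2) > 0"
    using \<kappa>_pos \<open>C2 > 0\<close> by simp
  from C1(2) B(2) eventually_in_U eventually_at_right_0[OF zero_less_one]
    eventually_at_right_0[OF this]
  have "\<forall>\<^sub>F \<epsilon> in at_right 0. \<forall>\<Delta>. norm \<Delta> \<le> 1 \<longrightarrow>
    \<bar>Re (eig \<epsilon> \<Delta> \<mu>0) - Re (eig \<epsilon> D \<mu>0) - \<epsilon> / \<kappa> * inner D (\<Delta> - D)\<bar> \<le> C * \<epsilon>\<^sup>2 * norm (\<Delta> - D)"
  proof eventually_elim
    case (elim \<epsilon>)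
    then have \<epsilon>: "0 < \<epsilon>" "\<epsilon> < 1" "\<epsilon> \<in> U" "C2 * \<epsilon> \<le> \<kappa> / 2"
      using \<open>C2 > 0\<close> by (auto simp: field_simps)
    show ?case
    proof (intro allI impI)
      fix \<Delta> :: "complex ^ 'n ^ 'n"
      assume "norm \<Delta> \<le> 1"
      then obtain v where v: "(A + \<epsilon> *\<^sub>R \<Delta>) *v v = eig \<epsilon> \<Delta> \<mu>0 *s v" "norm (v - x0) \<le> C1 * \<epsilon>"
        using elim(1) by blast
      define E p p0 q where "E = \<Delta> - D" and "p = cdot (Y \<epsilon>) (E *v v)" and "p0 = cdot y0 (E *v x0)"
        and "q = cdot (Y \<epsilon>) v"
      have "norm (Y \<epsilon> - y0) \<le> B * \<epsilon>"
        using elim \<epsilon> Y_eq[of \<epsilon>] by (simp add: mult.commute)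
      moreover have "norm v \<le> 1 + C1"
        using norm_triangle_sub[of v x0] v(2) mult_left_le[of \<epsilon> C1] \<epsilon> C1(1) by simp
      ultimately have close: "norm (Y \<epsilon> - y0) * norm v + norm y0 * norm (v - x0) \<le> C2 * \<epsilon>"
        using v(2) mult_mono[of "norm (Y \<epsilon> - y0)" "B * \<epsilon>" "norm v" "1 + C1"] B \<epsilon>
        by (simp add: C2_def algebra_simps)
      have p: "cmod (p - p0) \<le> C2 * \<epsilon> * norm E"
        unfolding p_def p0_def
        by (rule order_trans[OF cdot_matrix_diff_le mult_right_mono[OF close norm_ge_zero]])
      have q: "cmod (q - of_real \<kappa>) \<le> C2 * \<epsilon>"
        unfolding q_def cdot_y0_x0[symmetric] by (rule order_trans[OF cdot_diff_le close])
      then have q_ge: "\<kappa> / 2 \<le> cmod q"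
        using norm_triangle_ineq2[of "of_real \<kappa>" "of_real \<kappa> - q"] \<epsilon>(4) \<kappa>_pos
        by (simp add: norm_minus_commute)
      then have "q \<noteq> 0"
        using \<kappa>_pos by auto
      have p0: "cmod p0 \<le> norm E"
        using norm_cdot_le[of y0 "E *v x0"] norm_matrix_vector_le[of E x0] by (simp add: p0_def)
      have "eig \<epsilon> \<Delta> \<mu>0 * q = cdot (Y \<epsilon>) ((A + \<epsilon> *\<^sub>R \<Delta>) *v v)"
        by (simp add: v cdot_scale_right q_def)
      also have "A + \<epsilon> *\<^sub>R \<Delta> = (A + \<epsilon> *\<^sub>R D) + \<epsilon> *\<^sub>R E"
        by (simp add: E_def algebra_simps)
      also have "cdot (Y \<epsilon>) (\<dots> *v v) = eig \<epsilon> D \<mu>0 * q + of_real \<epsilon> * p"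
        unfolding matrix_vector_mult_add_rdistrib[of _ "\<epsilon> *\<^sub>R E"]
        by (simp add: cdot_add_right left_eigenvector \<epsilon> scaleR_matrix_vector cdot_scaleR_right
            q_def p_def)
      finally have "eig \<epsilon> \<Delta> \<mu>0 - eig \<epsilon> D \<mu>0 = of_real \<epsilon> * (p / q)"
        using \<open>q \<noteq> 0\<close> by (simp add: field_simps)
      moreover define R where "R = (p - p0) / q + p0 * (of_real \<kappa> - q) / (q * of_real \<kappa>)"
      have "p / q = p0 / of_real \<kappa> + R"
        unfolding R_def using \<open>q \<noteq> 0\<close> \<kappa>_pos by (simp add: field_simps)
      ultimately have "Re (eig \<epsilon> \<Delta> \<mu>0 - eig \<epsilon> D \<mu>0) = \<epsilon> * (Re (p0 / of_real \<kappa>) + Re R)"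
        by simp
      moreover have "Re (p0 / of_real \<kappa>) = inner D E / \<kappa>"
        by (simp add: p0_def Re_cdot_matrix_vector D_def Re_divide_of_real)
      ultimately have diff: "Re (eig \<epsilon> \<Delta> \<mu>0) - Re (eig \<epsilon> D \<mu>0) - \<epsilon> / \<kappa> * inner D E = \<epsilon> * Re R"
        using \<kappa>_pos by (auto simp: distrib_left)
      have "cmod R \<le> C * \<epsilon> * norm E"
      proof -
        have "cmod ((p - p0) / q) \<le> C2 * \<epsilon> * norm E / (\<kappa> / 2)"
          unfolding norm_divide
          by (rule frac_le[OF _ p _ q_ge]) (use \<kappa>_pos \<epsilon>(1) \<open>C2 > 0\<close> in simp_all)
        moreover have "cmod (p0 * (of_real \<kappa> - q) / (q * of_real \<kappa>)) \<le> norm E * (C2 * \<epsilon>) / (\<kappa> / 2 * \<kappa>)"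
          unfolding norm_divide
        proof (rule frac_le)
          show "cmod (p0 * (of_real \<kappa> - q)) \<le> norm E * (C2 * \<epsilon>)"
            unfolding norm_mult by (rule mult_mono) (use p0 q in \<open>simp_all add: norm_minus_commute\<close>)
          show "\<kappa> / 2 * \<kappa> \<le> cmod (q * of_real \<kappa>)"
            unfolding norm_mult using q_ge \<kappa>_pos by simp
        qed (use \<kappa>_pos \<epsilon>(1) \<open>C2 > 0\<close> in simp_all)
        ultimately have "cmod R
            \<le> C2 * \<epsilon> * norm E / (\<kappa> / 2) + norm E * (C2 * \<epsilon>) / (\<kappa> / 2 * \<kappa>)"
          unfolding R_def by (rule norm_triangle_mono)
        also have "\<dots> = C * \<epsilon> * norm E"
          using \<kappa>_pos by (simp add: C_def field_simps power2_eq_square)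
        finally show ?thesis .
      qed
      then have "\<epsilon> * \<bar>Re R\<bar> \<le> \<epsilon> * (C * \<epsilon> * norm E)"
        using \<epsilon>(1) order_trans[OF abs_Re_le_cmod] by (intro mult_left_mono) auto
      then show "\<bar>Re (eig \<epsilon> \<Delta> \<mu>0) - Re (eig \<epsilon> D \<mu>0) - \<epsilon> / \<kappa> * inner D (\<Delta> - D)\<bar>
          \<le> C * \<epsilon>\<^sup>2 * norm (\<Delta> - D)"
        unfolding E_def[symmetric] diff using \<epsilon>(1)
        by (simp add: abs_mult power2_eq_square mult_ac)
    qed
  qed
  moreover have "C \<ge> 0"
    using \<open>C2 > 0\<close> \<kappa>_pos by (simp add: C_def)
  ultimately show ?thesis
    by (intro that[of C])
qed

text \<open>
  The first-order loss \<open>\<epsilon>/(2\<kappa>) \<parallel>\<Delta> - D\<parallel>\<^sup>2\<close> outweighs the error \<open>C \<epsilon>\<^sup>2 \<parallel>\<Delta> - D\<parallel>\<close> up to \<open>O(\<epsilon>\<^sup>3)\<close>,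
  by completing the square.
\<close>
lemma max_Re_near_optimal:
  assumes T: "\<forall>\<^sub>F \<epsilon> in at_right 0. norm (T \<epsilon>) = 1 \<and> norm (T \<epsilon> - D) \<le> K * \<epsilon>"
  shows "(\<lambda>\<epsilon>. max_Re_eigenvalue A r \<epsilon> \<mu>0 - Re (eig \<epsilon> (T \<epsilon>) \<mu>0)) \<in> O[at_right 0](\<lambda>\<epsilon>. \<epsilon> ^ 3)"
proof -
  obtain C where C: "C \<ge> 0" "\<forall>\<^sub>F \<epsilon> in at_right 0. \<forall>\<Delta>. norm \<Delta> \<le> 1 \<longrightarrow>
    \<bar>Re (eig \<epsilon> \<Delta> \<mu>0) - Re (eig \<epsilon> D \<mu>0) - \<epsilon> / \<kappa> * inner D (\<Delta> - D)\<bar> \<le> C * \<epsilon>\<^sup>2 * norm (\<Delta> - D)"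
    by (rule eigenvalue_difference) blast
  define C' where "C' = \<kappa> * C\<^sup>2 / 2 + (K\<^sup>2 / (2 * \<kappa>) + C * K)"
  from C(2) T eventually_in_U eventually_at_right_less[of 0]
  have "\<forall>\<^sub>F \<epsilon> in at_right 0.
    norm (max_Re_eigenvalue A r \<epsilon> \<mu>0 - Re (eig \<epsilon> (T \<epsilon>) \<mu>0)) \<le> C' * norm (\<epsilon> ^ 3)"
  proof eventually_elim
    case (elim \<epsilon>)
    then have \<epsilon>: "0 < \<epsilon>" "\<epsilon> \<in> U" and T: "norm (T \<epsilon>) = 1" "norm (T \<epsilon> - D) \<le> K * \<epsilon>"
      by auto
    have upper: "Re (eig \<epsilon> \<Delta> \<mu>0) - Re (eig \<epsilon> D \<mu>0) \<le> \<kappa> * C\<^sup>2 / 2 * \<epsilon> ^ 3" if \<Delta>: "norm \<Delta> \<le> 1" for \<Delta>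
    proof -
      define E where "E = norm (\<Delta> - D)"
      have "inner D (\<Delta> - D) \<le> - (E\<^sup>2) / 2"
        using \<Delta> power_mono[OF \<Delta>, of 2] by (simp add: inner_unit_diff E_def)
      then have "\<epsilon> / \<kappa> * inner D (\<Delta> - D) \<le> \<epsilon> / \<kappa> * (- (E\<^sup>2) / 2)"
        using \<epsilon> \<kappa>_pos by (intro mult_left_mono) auto
      \<comment> \<open>completing the square in \<open>E\<close>\<close>
      moreover have "\<epsilon> / \<kappa> * (- (E\<^sup>2) / 2) + C * \<epsilon>\<^sup>2 * E
          = \<kappa> * C\<^sup>2 / 2 * \<epsilon> ^ 3 - \<epsilon> / (2 * \<kappa>) * (E - \<kappa> * C * \<epsilon>)\<^sup>2"
        using \<kappa>_pos by (simp add: field_simps power2_eq_square power3_eq_cube)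
      moreover have "\<epsilon> / (2 * \<kappa>) * (E - \<kappa> * C * \<epsilon>)\<^sup>2 \<ge> 0"
        using \<epsilon> \<kappa>_pos by simp
      ultimately show ?thesis
        using elim(1)[rule_format, OF \<Delta>] unfolding E_def[symmetric] by linarith
    qed
    obtain \<Delta>1 where \<Delta>1: "norm \<Delta>1 \<le> 1" "max_Re_eigenvalue A r \<epsilon> \<mu>0 = Re (eig \<epsilon> \<Delta>1 \<mu>0)"
      using max_Re_eigenvalue_attained(1)[OF \<mu>0 \<epsilon>(2)] by blast
    define E where "E = norm (T \<epsilon> - D)"
    have E: "0 \<le> E" "E \<le> K * \<epsilon>"
      using T by (auto simp: E_def)
    have "inner D (T \<epsilon> - D) = - (E\<^sup>2) / 2"
      using T by (simp add: inner_unit_diff E_def)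
    then have "\<epsilon> / \<kappa> * inner D (T \<epsilon> - D) = - (\<epsilon> / (2 * \<kappa>) * E\<^sup>2)"
      by simp
    then have "- (\<epsilon> / (2 * \<kappa>) * E\<^sup>2 + C * \<epsilon>\<^sup>2 * E) \<le> Re (eig \<epsilon> (T \<epsilon>) \<mu>0) - Re (eig \<epsilon> D \<mu>0)"
      using elim(1)[rule_format, of "T \<epsilon>"] T(1) unfolding E_def[symmetric] by linarith
    moreover have "\<epsilon> / (2 * \<kappa>) * E\<^sup>2 + C * \<epsilon>\<^sup>2 * E \<le> \<epsilon> / (2 * \<kappa>) * (K * \<epsilon>)\<^sup>2 + C * \<epsilon>\<^sup>2 * (K * \<epsilon>)"
      using \<epsilon> \<kappa>_pos C(1) E by (intro add_mono mult_left_mono power_mono) auto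
    moreover have "\<dots> = (K\<^sup>2 / (2 * \<kappa>) + C * K) * \<epsilon> ^ 3"
      using \<kappa>_pos by (simp add: field_simps power2_eq_square power3_eq_cube)
    ultimately have "max_Re_eigenvalue A r \<epsilon> \<mu>0 - Re (eig \<epsilon> (T \<epsilon>) \<mu>0) \<le> C' * \<epsilon> ^ 3"
      using upper[OF \<Delta>1(1)] unfolding \<Delta>1(2) C'_def by (simp add: distrib_right)
    moreover have "Re (eig \<epsilon> (T \<epsilon>) \<mu>0) \<le> max_Re_eigenvalue A r \<epsilon> \<mu>0"
      using max_Re_eigenvalue_attained(2)[OF \<mu>0 \<epsilon>(2)] T(1) by simp
    ultimately show ?case
      using \<epsilon>(1) by simp
  qed
  then show ?thesis
    by (rule bigoI)
qed

end

section \<open>Second-order expansions\<close>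

text \<open>
  This is the expansion of \<open>z = \<epsilon> (1 + \<epsilon>a) / (k + \<epsilon>b)\<close> to second order, with an explicit constant.
  Multiplied by \<open>k + \<epsilon>b\<close>, the error becomes the monomial \<open>\<epsilon>\<^sup>3 b (b/k - a) / k\<close>.
\<close>
lemma quotient_expansion:
  fixes z a b :: complex
  assumes z: "z * (of_real k + of_real \<epsilon> * b) = of_real \<epsilon> * (1 + of_real \<epsilon> * a)"
    and k: "k > 0" and \<epsilon>: "0 < \<epsilon>" and B: "cmod a \<le> B" "cmod b \<le> B" and small: "B * \<epsilon> \<le> k / 2"
  shows "cmod (z - of_real (\<epsilon> / k) * (1 + of_real \<epsilon> * (a - b / of_real k)))
           \<le> 2 * B * (B / k + B) / k\<^sup>2 * \<epsilon> ^ 3"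
proof -
  define e where "e = z - of_real (\<epsilon> / k) * (1 + of_real \<epsilon> * (a - b / of_real k))"
  define t where "t = B / k + B"
  have "B \<ge> 0"
    using B(1) norm_ge_zero order_trans by blast
  have "(of_real k + of_real \<epsilon> * b) * e = of_real \<epsilon> * (1 + of_real \<epsilon> * a)
      - (of_real k + of_real \<epsilon> * b) * (of_real (\<epsilon> / k) * (1 + of_real \<epsilon> * (a - b / of_real k)))"
    using z by (simp add: e_def algebra_simps)
  also have "\<dots> = of_real (\<epsilon> ^ 3) * (b * (b / of_real k - a)) / of_real k"
    using k by (simp add: field_simps power3_eq_cube power2_eq_square)
  finally have eq: "(of_real k + of_real \<epsilon> * b) * e
      = of_real (\<epsilon> ^ 3) * (b * (b / of_real k - a)) / of_real k" .
  have "cmod (b / of_real k - a) \<le> t"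
    unfolding t_def using B k by (intro order_trans[OF norm_triangle_ineq4] add_mono)
      (auto simp: norm_divide divide_right_mono)
  then have "cmod (b * (b / of_real k - a)) \<le> B * t"
    unfolding norm_mult using B \<open>B \<ge> 0\<close> by (intro mult_mono) auto
  then have "\<epsilon> ^ 3 * cmod (b * (b / of_real k - a)) / k \<le> \<epsilon> ^ 3 * (B * t) / k"
    using k \<epsilon> by (intro divide_right_mono mult_left_mono) auto
  then have upper: "cmod (of_real k + of_real \<epsilon> * b) * cmod e \<le> \<epsilon> ^ 3 * (B * t) / k"
    unfolding norm_mult[symmetric] eq using k \<epsilon> by (simp add: norm_divide norm_mult norm_power)
  have "\<epsilon> * cmod b \<le> k / 2"
    using mult_left_mono[OF B(2) less_imp_le[OF \<epsilon>]] small
    by (simp only: mult.commute[of B])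
  then have "k / 2 \<le> cmod (of_real k + of_real \<epsilon> * b)"
    using norm_triangle_ineq2[of "of_real k" "- (of_real \<epsilon> * b)"] k \<epsilon> by (simp add: norm_mult)
  then have "k / 2 * cmod e \<le> cmod (of_real k + of_real \<epsilon> * b) * cmod e"
    by (intro mult_right_mono) auto
  with upper have "k / 2 * cmod e \<le> \<epsilon> ^ 3 * (B * t) / k"
    by linarith
  then have "cmod e \<le> \<epsilon> ^ 3 * (B * t) / k * 2 / k"
    using k by (simp add: field_simps)
  then show ?thesis
    unfolding e_def[symmetric] t_def[symmetric] by (simp add: power2_eq_square mult_ac)
qed

lemma abs_average_le:
  fixes e1 e2 u c d v :: real
  assumes "\<bar>e1\<bar> \<le> c" "\<bar>e2\<bar> \<le> c" "\<bar>u\<bar> \<le> d"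
  shows "\<bar>(e1 + e2) / 2 + u\<bar> \<le> c + d"
proof -
  have "e1 \<le> c" "- e1 \<le> c" "e2 \<le> c" "- e2 \<le> c" "u \<le> d" "- u \<le> d"
    using assms by (auto simp: abs_le_iff)
  then show ?thesis
    by (intro abs_leI) (simp_all add: field_simps)
qed

context analytic_eigentriple
begin

lemma Re_\<beta>: "Re (\<beta> s) = - (inner (qY s) x0 + inner y0 (qX s)) / \<kappa>"
proof -
  have "\<beta> s = - (cdot (qY s) x0 + cdot y0 (qX s)) / of_real \<kappa>"
    by (simp only: \<beta>_def cdot_y0_x0 times_divide_eq_left mult_minus_left mult_1_left)
  then show ?thesis
    by (simp only: Re_divide_of_real uminus_complex.sel plus_complex.sel Re_cdot)
qed

lemma inner_x0_qX:
  assumes "s \<in> U" "s > 0"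
  shows "inner x0 (qX s) = - s * (norm (qX s))\<^sup>2 / 2"
proof (rule unit_difference_quotient)
  show "norm (x0 + s *\<^sub>R qX s) = 1"
    using norm_X[OF assms(1)] assms(2) by (subst X_eq[symmetric]) simp_all
qed (use assms in simp_all)

lemma inner_y0_qY:
  assumes "s \<in> U" "s > 0"
  shows "inner y0 (qY s) = - s * (norm (qY s))\<^sup>2 / 2"
proof (rule unit_difference_quotient)
  show "norm (y0 + s *\<^sub>R qY s) = 1"
    using norm_Y[OF assms(1)] assms(2) by (subst Y_eq[symmetric]) simp_all
qed (use assms in simp_all)

text \<open>
  The right and the left eigenvector give two expansions of the eigenvalue, whose second-order terms
  contain \<open>y0\<^sup>* qX\<close> and \<open>qY\<^sup>* x0\<close>. Their average has the sum of both, which is \<open>- \<kappa> \<beta>\<close>; the remaining terms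
  \<open>x0\<^sup>* qX\<close> and \<open>qY\<^sup>* y0\<close> have real part \<open>O(\<epsilon>)\<close>.
\<close>
lemma Re_eig_D_expansion:
  "(\<lambda>\<epsilon>. Re (eig \<epsilon> D \<mu>0) - (Re \<mu>0 + \<epsilon> / \<kappa> * (1 + \<epsilon> / 2 * Re (\<beta> \<epsilon>)))) \<in> O[at_right 0](\<lambda>\<epsilon>. \<epsilon> ^ 3)"
proof -
  obtain B where B: "B > 0" "\<forall>\<^sub>F s in at_right 0. norm (qX s) \<le> B \<and> norm (qY s) \<le> B"
    by (rule quotients_bounded) blast
  define C where "C = 2 * B * (B / \<kappa> + B) / \<kappa>\<^sup>2"
  have "\<kappa> / (2 * B) > 0"
    using B \<kappa>_pos by simp
  from B(2) eventually_in_U eventually_at_right_0[OF this]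
  have "\<forall>\<^sub>F \<epsilon> in at_right 0.
    norm (Re (eig \<epsilon> D \<mu>0) - (Re \<mu>0 + \<epsilon> / \<kappa> * (1 + \<epsilon> / 2 * Re (\<beta> \<epsilon>))))
      \<le> (C + B\<^sup>2 / (2 * \<kappa>)) * norm (\<epsilon> ^ 3)"
  proof eventually_elim
    case (elim \<epsilon>)
    then have \<epsilon>: "0 < \<epsilon>" "\<epsilon> \<in> U" "B * \<epsilon> \<le> \<kappa> / 2" and q: "norm (qX \<epsilon>) \<le> B" "norm (qY \<epsilon>) \<le> B"
      using B(1) by (auto simp: field_simps)
    define z where "z = eig \<epsilon> D \<mu>0 - \<mu>0"
    have Dv: "D *v v = cdot x0 v *s y0" for v
      by (simp add: D_def outer_vector)
    have X: "X \<epsilon> = x0 + \<epsilon> *\<^sub>R qX \<epsilon>" and Y: "Y \<epsilon> = y0 + \<epsilon> *\<^sub>R qY \<epsilon>"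
      using \<epsilon>(1) X_eq[of \<epsilon>] Y_eq[of \<epsilon>] by simp_all
    have "eig \<epsilon> D \<mu>0 * cdot y0 (X \<epsilon>) = cdot y0 ((A + \<epsilon> *\<^sub>R D) *v X \<epsilon>)"
      by (simp add: right_eigenvector \<epsilon> cdot_scale_right)
    also have "\<dots> = \<mu>0 * cdot y0 (X \<epsilon>) + of_real \<epsilon> * cdot x0 (X \<epsilon>)"
      by (simp add: matrix_vector_mult_add_rdistrib cdot_add_right y0 scaleR_matrix_vector
          cdot_scaleR_right Dv cdot_scale_right cdot_self)
    finally have "z * cdot y0 (X \<epsilon>) = of_real \<epsilon> * cdot x0 (X \<epsilon>)"
      by (simp add: z_def algebra_simps)
    then have "z * (of_real \<kappa> + of_real \<epsilon> * cdot y0 (qX \<epsilon>))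
        = of_real \<epsilon> * (1 + of_real \<epsilon> * cdot x0 (qX \<epsilon>))"
      by (simp add: X cdot_add_right cdot_scaleR_right cdot_y0_x0 cdot_self)
    moreover have "cmod (cdot x0 (qX \<epsilon>)) \<le> B" "cmod (cdot y0 (qX \<epsilon>)) \<le> B"
      using norm_cdot_le[of x0 "qX \<epsilon>"] norm_cdot_le[of y0 "qX \<epsilon>"] q by auto
    ultimately have 1: "cmod (z - of_real (\<epsilon> / \<kappa>) * (1 + of_real \<epsilon> *
        (cdot x0 (qX \<epsilon>) - cdot y0 (qX \<epsilon>) / of_real \<kappa>))) \<le> C * \<epsilon> ^ 3"
      unfolding C_def using \<kappa>_pos \<epsilon> by (intro quotient_expansion) auto
    have "eig \<epsilon> D \<mu>0 * cdot (Y \<epsilon>) x0 = cdot (Y \<epsilon>) ((A + \<epsilon> *\<^sub>R D) *v x0)"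
      by (simp add: left_eigenvector \<epsilon>)
    also have "\<dots> = \<mu>0 * cdot (Y \<epsilon>) x0 + of_real \<epsilon> * cdot (Y \<epsilon>) y0"
      by (simp add: matrix_vector_mult_add_rdistrib cdot_add_right x0 scaleR_matrix_vector
          cdot_scaleR_right Dv cdot_scale_right cdot_self)
    finally have "z * cdot (Y \<epsilon>) x0 = of_real \<epsilon> * cdot (Y \<epsilon>) y0"
      by (simp add: z_def algebra_simps)
    then have "z * (of_real \<kappa> + of_real \<epsilon> * cdot (qY \<epsilon>) x0)
        = of_real \<epsilon> * (1 + of_real \<epsilon> * cdot (qY \<epsilon>) y0)"
      by (simp add: Y cdot_add_left cdot_scaleR_left cdot_y0_x0 cdot_self)
    moreover have "cmod (cdot (qY \<epsilon>) y0) \<le> B" "cmod (cdot (qY \<epsilon>) x0) \<le> B"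
      using norm_cdot_le[of "qY \<epsilon>" y0] norm_cdot_le[of "qY \<epsilon>" x0] q by auto
    ultimately have 2: "cmod (z - of_real (\<epsilon> / \<kappa>) * (1 + of_real \<epsilon> *
        (cdot (qY \<epsilon>) y0 - cdot (qY \<epsilon>) x0 / of_real \<kappa>))) \<le> C * \<epsilon> ^ 3"
      unfolding C_def using \<kappa>_pos \<epsilon> by (intro quotient_expansion) auto
    define a1 a2 b1 b2 where "a1 = inner x0 (qX \<epsilon>)" and "a2 = inner (qY \<epsilon>) y0"
      and "b1 = inner y0 (qX \<epsilon>)" and "b2 = inner (qY \<epsilon>) x0"
    have Re_eq: "Re (of_real (\<epsilon> / \<kappa>) * (1 + of_real \<epsilon> * (a - b / of_real \<kappa>)))
        = \<epsilon> / \<kappa> * (1 + \<epsilon> * (Re a - Re b / \<kappa>))" for a b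
      by (simp add: Re_divide_of_real del: of_real_divide)
    have "\<bar>Re z - \<epsilon> / \<kappa> * (1 + \<epsilon> * (a1 - b1 / \<kappa>))\<bar> \<le> C * \<epsilon> ^ 3"
      and "\<bar>Re z - \<epsilon> / \<kappa> * (1 + \<epsilon> * (a2 - b2 / \<kappa>))\<bar> \<le> C * \<epsilon> ^ 3"
      using order_trans[OF abs_Re_le_cmod 1] order_trans[OF abs_Re_le_cmod 2]
      unfolding minus_complex.sel Re_eq Re_cdot a1_def a2_def b1_def b2_def by blast+
    moreover
    have "\<epsilon>\<^sup>2 / (2 * \<kappa>) * \<bar>a1 + a2\<bar> \<le> B\<^sup>2 / (2 * \<kappa>) * \<epsilon> ^ 3"
    proof -
      have "\<bar>a1 + a2\<bar> = \<epsilon> * ((norm (qX \<epsilon>))\<^sup>2 + (norm (qY \<epsilon>))\<^sup>2) / 2"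
      proof -
        have "a1 + a2 = - (\<epsilon> * ((norm (qX \<epsilon>))\<^sup>2 + (norm (qY \<epsilon>))\<^sup>2) / 2)"
          using inner_x0_qX[OF \<epsilon>(2,1)] inner_y0_qY[OF \<epsilon>(2,1)]
          by (simp add: a1_def a2_def inner_commute[of _ y0] field_simps)
        moreover have "0 \<le> \<epsilon> * ((norm (qX \<epsilon>))\<^sup>2 + (norm (qY \<epsilon>))\<^sup>2) / 2"
          using \<epsilon>(1) by simp
        ultimately show ?thesis
          by linarith
      qed
      also have "\<dots> \<le> \<epsilon> * (B\<^sup>2 + B\<^sup>2) / 2"
        using q \<epsilon>(1) by (intro divide_right_mono mult_left_mono add_mono power_mono) auto
      finally have "\<epsilon>\<^sup>2 / (2 * \<kappa>) * \<bar>a1 + a2\<bar> \<le> \<epsilon>\<^sup>2 / (2 * \<kappa>) * (\<epsilon> * B\<^sup>2)"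
        using \<kappa>_pos by (intro mult_left_mono) auto
      then show ?thesis
        by (simp add: power2_eq_square power3_eq_cube mult_ac)
    qed
    then have "\<bar>\<epsilon>\<^sup>2 / (2 * \<kappa>) * (a1 + a2)\<bar> \<le> B\<^sup>2 / (2 * \<kappa>) * \<epsilon> ^ 3"
      using \<kappa>_pos by (simp add: abs_mult)
    ultimately have "\<bar>((Re z - \<epsilon> / \<kappa> * (1 + \<epsilon> * (a1 - b1 / \<kappa>)))
        + (Re z - \<epsilon> / \<kappa> * (1 + \<epsilon> * (a2 - b2 / \<kappa>)))) / 2
        + \<epsilon>\<^sup>2 / (2 * \<kappa>) * (a1 + a2)\<bar> \<le> C * \<epsilon> ^ 3 + B\<^sup>2 / (2 * \<kappa>) * \<epsilon> ^ 3"
      by (rule abs_average_le)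
    also have "((Re z - \<epsilon> / \<kappa> * (1 + \<epsilon> * (a1 - b1 / \<kappa>)))
        + (Re z - \<epsilon> / \<kappa> * (1 + \<epsilon> * (a2 - b2 / \<kappa>)))) / 2
        + \<epsilon>\<^sup>2 / (2 * \<kappa>) * (a1 + a2) = Re z - \<epsilon> / \<kappa> * (1 + \<epsilon> / 2 * Re (\<beta> \<epsilon>))"
      using \<kappa>_pos by (simp add: Re_\<beta> b1_def b2_def field_simps power2_eq_square)
    finally have "\<bar>Re z - \<epsilon> / \<kappa> * (1 + \<epsilon> / 2 * Re (\<beta> \<epsilon>))\<bar> \<le> C * \<epsilon> ^ 3 + B\<^sup>2 / (2 * \<kappa>) * \<epsilon> ^ 3" .
    then show ?case
      using \<epsilon>(1) by (simp add: z_def algebra_simps)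
  qed
  then show ?thesis
    by (rule bigoI)
qed

lemma inner_D_W:
  assumes "s \<in> U" "s > 0"
  shows "inner D (W s) = Re (\<beta> s) - s * ((norm (qX s))\<^sup>2 + (norm (qY s))\<^sup>2) / 2"
proof -
  have "inner D (W s) = Re (cdot y0 (W s *v x0))"
    by (simp add: D_def Re_cdot_matrix_vector)
  also have "W s *v x0 = qY s + cdot (qX s) x0 *s y0 + \<beta> s *s y0"
    by (simp add: W_def matrix_vector_mult_add_rdistrib outer_vector cmat_scale_vector D_def cdot_self)
  also have "Re (cdot y0 \<dots>) = inner y0 (qY s) + inner x0 (qX s) + Re (\<beta> s)"
    by (simp add: cdot_add_right cdot_scale_right cdot_self Re_cdot inner_commute)
  finally show ?thesis
    using inner_x0_qX[OF assms] inner_y0_qY[OF assms] by (simp add: field_simps)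
qed

lemma norm_W_le:
  assumes "norm (qX s) \<le> B" "norm (qY s) \<le> B"
  shows "norm (W s) \<le> 2 * B + 2 * B / \<kappa>"
proof -
  have "cmod (cdot (qY s) x0 + cdot y0 (qX s)) \<le> B + B"
    using norm_cdot_le[of "qY s" x0] norm_cdot_le[of y0 "qX s"] assms
    by (intro order_trans[OF norm_triangle_ineq add_mono]) auto
  then have "cmod (\<beta> s) \<le> 2 * B / \<kappa>"
    using \<kappa>_pos by (simp add: \<beta>_def cdot_y0_x0 norm_mult norm_divide field_simps)
  then have "norm (cmat_scale (\<beta> s) D) \<le> 2 * B / \<kappa>"
    by (simp add: norm_cmat_scale)
  moreover have "norm (outer (qY s) x0 + outer y0 (qX s)) \<le> B + B"
    using assms by (intro order_trans[OF norm_triangle_ineq add_mono]) (auto simp: norm_outer)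
  ultimately show ?thesis
    unfolding W_def by (intro order_trans[OF norm_triangle_ineq]) simp
qed

text \<open>
  The difference quotients at the step \<open>h \<epsilon>\<close> are bounded, so the ascent matrix is within \<open>O(\<epsilon>)\<close> of the
  unit matrix \<open>D\<close>, and normalizing it at most doubles the distance.
\<close>
lemma ascent_direction_near_D:
  assumes h: "filterlim h (at_right 0) (at_right 0)"
  obtains K where "\<forall>\<^sub>F \<epsilon> in at_right 0.
    norm (ascent (h \<epsilon>) \<epsilon> /\<^sub>R norm (ascent (h \<epsilon>) \<epsilon>)) = 1 \<and>
    norm (ascent (h \<epsilon>) \<epsilon> /\<^sub>R norm (ascent (h \<epsilon>) \<epsilon>) - D) \<le> K * \<epsilon>"
proof -
  obtain B where B: "B > 0" "\<forall>\<^sub>F s in at_right 0. norm (qX s) \<le> B \<and> norm (qY s) \<le> B"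
    by (rule quotients_bounded) blast
  define V where "V = 2 * B + 2 * B / \<kappa>"
  have "V > 0"
    using B(1) \<kappa>_pos by (simp add: V_def add_pos_pos)
  then have "1 / V > 0"
    by simp
  from eventually_compose_filterlim[OF B(2) h] eventually_at_right_0[OF this]
  have "\<forall>\<^sub>F \<epsilon> in at_right 0.
    norm (ascent (h \<epsilon>) \<epsilon> /\<^sub>R norm (ascent (h \<epsilon>) \<epsilon>)) = 1 \<and>
    norm (ascent (h \<epsilon>) \<epsilon> /\<^sub>R norm (ascent (h \<epsilon>) \<epsilon>) - D) \<le> V * \<epsilon>"
  proof eventually_elim
    case (elim \<epsilon>)
    define M where "M = ascent (h \<epsilon>) \<epsilon>"
    have W: "norm (W (h \<epsilon>)) \<le> V"
      unfolding V_def using elim by (intro norm_W_le) auto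
    have \<epsilon>: "0 < \<epsilon>" "V * \<epsilon> < 1"
      using elim \<open>V > 0\<close> by (auto simp: field_simps)
    have "norm (M - D) = \<epsilon> / 2 * norm (W (h \<epsilon>))"
      using \<epsilon>(1) by (simp add: M_def ascent_def)
    also have "\<dots> \<le> \<epsilon> / 2 * V"
      using \<epsilon>(1) W by (intro mult_left_mono) auto
    finally have close: "2 * norm (M - D) \<le> V * \<epsilon>"
      by (simp add: mult.commute)
    have "M \<noteq> 0"
      using close \<epsilon>(2) by auto
    then show ?case
      using norm_normalized_diff_le[OF norm_D, of M] close unfolding M_def[symmetric] by simp
  qed
  then show ?thesis
    by (rule that)
qed

text \<open>
  By \<open>norm_add_unit_bounds\<close> the norm is \<open>1 + (\<epsilon>/2) \<langle>D, W (h \<epsilon>)\<rangle> + O(\<epsilon>\<^sup>2)\<close>. The inner product is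
  \<open>Re (\<beta> (h \<epsilon>)) + O(h \<epsilon>)\<close>, and passing from the step \<open>h \<epsilon>\<close> to the step \<open>\<epsilon>\<close> changes \<open>\<beta>\<close> by \<open>O(\<epsilon>)\<close>, since
  both difference quotients are within \<open>O(\<epsilon>)\<close> of the derivative.
\<close>
lemma norm_ascent_expansion:
  assumes h: "filterlim h (at_right 0) (at_right 0)" and H: "\<forall>\<^sub>F \<epsilon> in at_right 0. h \<epsilon> \<le> H * \<epsilon>"
  shows "(\<lambda>\<epsilon>. \<epsilon> / \<kappa> * (1 + \<epsilon> / 2 * Re (\<beta> \<epsilon>)) - \<epsilon> / \<kappa> * norm (ascent (h \<epsilon>) \<epsilon>))
    \<in> O[at_right 0](\<lambda>\<epsilon>. \<epsilon> ^ 3)"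
proof -
  obtain B where B: "B > 0" "\<forall>\<^sub>F s in at_right 0. norm (qX s) \<le> B \<and> norm (qY s) \<le> B"
    by (rule quotients_bounded) blast
  obtain dx dy K where K: "K \<ge> 0"
    "\<forall>\<^sub>F s in at_right 0. norm (qX s - dx) \<le> K * s \<and> norm (qY s - dy) \<le> K * s"
    by (rule quotients_Lipschitz) blast
  define V where "V = 2 * B + 2 * B / \<kappa>"
  define L where "L = K * (H + 1)"
  define C where "C = H * B\<^sup>2 / 2 + V\<^sup>2 / 8 + L / \<kappa>"
  from K(2) eventually_compose_filterlim[OF B(2) h] eventually_compose_filterlim[OF K(2) h]
    eventually_compose_filterlim[OF eventually_in_U h]
    eventually_compose_filterlim[OF eventually_at_right_less h] H eventually_at_right_less[of 0]
  have "\<forall>\<^sub>F \<epsilon> in at_right 0.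
    norm (\<epsilon> / \<kappa> * (1 + \<epsilon> / 2 * Re (\<beta> \<epsilon>)) - \<epsilon> / \<kappa> * norm (ascent (h \<epsilon>) \<epsilon>)) \<le> C / \<kappa> * norm (\<epsilon> ^ 3)"
  proof eventually_elim
    case (elim \<epsilon>)
    define s where "s = h \<epsilon>"
    have s: "s > 0" "s \<in> U" "s \<le> H * \<epsilon>" and \<epsilon>: "\<epsilon> > 0"
      and q: "norm (qX s) \<le> B" "norm (qY s) \<le> B"
      and d: "norm (qX s - dx) \<le> K * s" "norm (qY s - dy) \<le> K * s"
        "norm (qX \<epsilon> - dx) \<le> K * \<epsilon>" "norm (qY \<epsilon> - dy) \<le> K * \<epsilon>"
      using elim by (auto simp: s_def)
    have "K * s + K * \<epsilon> \<le> L * \<epsilon>"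
      using mult_left_mono[OF s(3) K(1)] by (simp add: L_def algebra_simps)
    moreover have "norm (qX s - qX \<epsilon>) \<le> K * s + K * \<epsilon>" "norm (qY s - qY \<epsilon>) \<le> K * s + K * \<epsilon>"
      using d norm_triangle_ineq4[of "qX s - dx" "qX \<epsilon> - dx"]
        norm_triangle_ineq4[of "qY s - dy" "qY \<epsilon> - dy"] by simp_all
    ultimately have close: "norm (qX s - qX \<epsilon>) \<le> L * \<epsilon>" "norm (qY s - qY \<epsilon>) \<le> L * \<epsilon>"
      by linarith+
    have "\<bar>Re (\<beta> s) - Re (\<beta> \<epsilon>)\<bar> = \<bar>inner (qY s - qY \<epsilon>) x0 + inner y0 (qX s - qX \<epsilon>)\<bar> / \<kappa>"
      using \<kappa>_pos by (simp add: Re_\<beta> inner_diff_left inner_diff_right abs_divide flip: diff_divide_distrib)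
    also have "\<dots> \<le> (L * \<epsilon> + L * \<epsilon>) / \<kappa>"
      using close Cauchy_Schwarz_ineq2[of "qY s - qY \<epsilon>" x0] Cauchy_Schwarz_ineq2[of y0 "qX s - qX \<epsilon>"]
        \<kappa>_pos by (intro divide_right_mono) auto
    finally have "\<epsilon> / 2 * \<bar>Re (\<beta> s) - Re (\<beta> \<epsilon>)\<bar> \<le> \<epsilon> / 2 * ((L * \<epsilon> + L * \<epsilon>) / \<kappa>)"
      using \<epsilon> by (intro mult_left_mono) auto
    moreover have "\<bar>\<epsilon> / 2 * Re (\<beta> s) - \<epsilon> / 2 * Re (\<beta> \<epsilon>)\<bar> = \<epsilon> / 2 * \<bar>Re (\<beta> s) - Re (\<beta> \<epsilon>)\<bar>"
      using \<epsilon> unfolding right_diff_distrib[symmetric] abs_mult by simp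
    moreover have "\<epsilon> / 2 * ((L * \<epsilon> + L * \<epsilon>) / \<kappa>) = L / \<kappa> * \<epsilon>\<^sup>2"
      by (simp add: power2_eq_square)
    ultimately have 1: "\<bar>\<epsilon> / 2 * Re (\<beta> s) - \<epsilon> / 2 * Re (\<beta> \<epsilon>)\<bar> \<le> L / \<kappa> * \<epsilon>\<^sup>2"
      by linarith
    define w where "w = (\<epsilon> / 2) *\<^sub>R W s"
    define Q where "Q = (norm (qX s))\<^sup>2 + (norm (qY s))\<^sup>2"
    have Q: "0 \<le> Q" "Q \<le> 2 * B\<^sup>2"
      using q power_mono[OF q(1), of 2] power_mono[OF q(2), of 2] by (auto simp: Q_def)
    have "s * Q \<le> H * \<epsilon> * (2 * B\<^sup>2)"
      using s Q by (intro mult_mono) auto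
    then have "\<epsilon> / 4 * (s * Q) \<le> \<epsilon> / 4 * (H * \<epsilon> * (2 * B\<^sup>2))"
      using \<epsilon> by (intro mult_left_mono) auto
    then have 2: "\<epsilon> / 4 * (s * Q) \<le> H * B\<^sup>2 / 2 * \<epsilon>\<^sup>2"
      by (simp add: power2_eq_square mult_ac)
    have 3: "0 \<le> \<epsilon> / 4 * (s * Q)"
      using \<epsilon> s Q by simp
    have 4: "inner D w = \<epsilon> / 2 * Re (\<beta> s) - \<epsilon> / 4 * (s * Q)"
      by (simp add: w_def inner_D_W[OF s(2,1)] Q_def[symmetric] right_diff_distrib)
    have "norm w \<le> \<epsilon> / 2 * V"
      using norm_W_le[OF q] \<epsilon> by (simp add: w_def V_def)
    then have "(norm w)\<^sup>2 \<le> (\<epsilon> / 2 * V)\<^sup>2"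
      by (intro power_mono) auto
    then have 5: "(norm w)\<^sup>2 / 2 \<le> V\<^sup>2 / 8 * \<epsilon>\<^sup>2"
      by (simp add: power_mult_distrib power_divide mult_ac)
    have "norm (ascent s \<epsilon>) = norm (D + w)"
      by (simp add: ascent_def w_def)
    then have "\<bar>norm (ascent s \<epsilon>) - (1 + \<epsilon> / 2 * Re (\<beta> s))\<bar> \<le> H * B\<^sup>2 / 2 * \<epsilon>\<^sup>2 + V\<^sup>2 / 8 * \<epsilon>\<^sup>2"
      using norm_add_unit_bounds[OF norm_D, of w] 2 3 4 5 zero_le_power2[of "norm w"] by linarith
    with 1 have "\<bar>1 + \<epsilon> / 2 * Re (\<beta> \<epsilon>) - norm (ascent s \<epsilon>)\<bar> \<le> C * \<epsilon>\<^sup>2"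
      unfolding C_def distrib_right by linarith
    then have "\<epsilon> / \<kappa> * \<bar>1 + \<epsilon> / 2 * Re (\<beta> \<epsilon>) - norm (ascent s \<epsilon>)\<bar> \<le> \<epsilon> / \<kappa> * (C * \<epsilon>\<^sup>2)"
      using \<epsilon> \<kappa>_pos by (intro mult_left_mono) auto
    moreover have "\<bar>\<epsilon> / \<kappa> * (1 + \<epsilon> / 2 * Re (\<beta> \<epsilon>)) - \<epsilon> / \<kappa> * norm (ascent s \<epsilon>)\<bar>
        = \<epsilon> / \<kappa> * \<bar>1 + \<epsilon> / 2 * Re (\<beta> \<epsilon>) - norm (ascent s \<epsilon>)\<bar>"
      using \<epsilon> \<kappa>_pos unfolding right_diff_distrib[symmetric] abs_mult by simp
    moreover have "\<epsilon> / \<kappa> * (C * \<epsilon>\<^sup>2) = C / \<kappa> * norm (\<epsilon> ^ 3)"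
      using \<epsilon> by (simp add: power2_eq_square power3_eq_cube)
    ultimately show ?case
      unfolding s_def real_norm_def by linarith
  qed
  then show ?thesis
    by (rule bigoI)
qed

lemma max_Re_ascent_direction:
  assumes h: "filterlim h (at_right 0) (at_right 0)"
  shows "(\<lambda>\<epsilon>. max_Re_eigenvalue A r \<epsilon> \<mu>0
      - Re (eig \<epsilon> (ascent (h \<epsilon>) \<epsilon> /\<^sub>R norm (ascent (h \<epsilon>) \<epsilon>)) \<mu>0)) \<in> O[at_right 0](\<lambda>\<epsilon>. \<epsilon> ^ 3)"
  by (rule ascent_direction_near_D[OF h]) (rule max_Re_near_optimal)

lemma max_Re_norm_ascent:
  assumes h: "filterlim h (at_right 0) (at_right 0)" and H: "\<forall>\<^sub>F \<epsilon> in at_right 0. h \<epsilon> \<le> H * \<epsilon>"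
  shows "(\<lambda>\<epsilon>. max_Re_eigenvalue A r \<epsilon> \<mu>0 - (Re \<mu>0 + \<epsilon> / \<kappa> * norm (ascent (h \<epsilon>) \<epsilon>)))
    \<in> O[at_right 0](\<lambda>\<epsilon>. \<epsilon> ^ 3)"
proof -
  have "(\<lambda>\<epsilon>. max_Re_eigenvalue A r \<epsilon> \<mu>0 - Re (eig \<epsilon> D \<mu>0)) \<in> O[at_right 0](\<lambda>\<epsilon>. \<epsilon> ^ 3)"
    by (rule max_Re_near_optimal[where K = 0]) simp
  from sum_in_bigo(1)[OF sum_in_bigo(1)[OF this Re_eig_D_expansion] norm_ascent_expansion[OF h H]]
  show ?thesis
    by (simp add: algebra_simps)
qed

end

section \<open>The expansions of the pseudospectral abscissa\<close>

text \<open>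
  The difference of the two maxima is at most the sum of the \<open>\<bar>f m - g m\<bar>\<close>.
\<close>
lemma Max_diff_bigo:
  fixes f g :: "'b \<Rightarrow> 'a \<Rightarrow> real"
  assumes S: "finite S" "S \<noteq> {}" and "\<And>m. m \<in> S \<Longrightarrow> (\<lambda>\<epsilon>. f m \<epsilon> - g m \<epsilon>) \<in> O[F](k)"
  shows "(\<lambda>\<epsilon>. (MAX m\<in>S. f m \<epsilon>) - (MAX m\<in>S. g m \<epsilon>)) \<in> O[F](k)"
proof -
  have one_sided: "(MAX m\<in>S. f m \<epsilon>) \<le> (MAX m\<in>S. g m \<epsilon>) + (\<Sum>m\<in>S. \<bar>f m \<epsilon> - g m \<epsilon>\<bar>)"
    for f g :: "'b \<Rightarrow> 'a \<Rightarrow> real" and \<epsilon>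
  proof (rule Max.boundedI)
    fix t
    assume "t \<in> (\<lambda>m. f m \<epsilon>) ` S"
    then obtain m where m: "m \<in> S" "t = f m \<epsilon>"
      by blast
    have "g m \<epsilon> \<le> (MAX m\<in>S. g m \<epsilon>)"
      using S(1) m(1) by simp
    moreover have "\<bar>f m \<epsilon> - g m \<epsilon>\<bar> \<le> (\<Sum>m\<in>S. \<bar>f m \<epsilon> - g m \<epsilon>\<bar>)"
      using S(1) m(1) by (intro member_le_sum) auto
    ultimately show "t \<le> (MAX m\<in>S. g m \<epsilon>) + (\<Sum>m\<in>S. \<bar>f m \<epsilon> - g m \<epsilon>\<bar>)"
      using m(2) by linarith
  qed (use S in auto)
  have "norm ((MAX m\<in>S. f m \<epsilon>) - (MAX m\<in>S. g m \<epsilon>)) \<le> norm (\<Sum>m\<in>S. \<bar>f m \<epsilon> - g m \<epsilon>\<bar>)" for \<epsilon>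
    using one_sided[of f \<epsilon> g] one_sided[of g \<epsilon> f] by (simp add: abs_minus_commute sum_nonneg abs_le_iff)
  then have "(\<lambda>\<epsilon>. (MAX m\<in>S. f m \<epsilon>) - (MAX m\<in>S. g m \<epsilon>)) \<in> O[F](\<lambda>\<epsilon>. \<Sum>m\<in>S. \<bar>f m \<epsilon> - g m \<epsilon>\<bar>)"
    by (intro landau_o.big_mono always_eventually) auto
  moreover have "(\<lambda>\<epsilon>. \<Sum>m\<in>S. \<bar>f m \<epsilon> - g m \<epsilon>\<bar>) \<in> O[F](k)"
    using assms(3) by (intro big_sum_in_bigo) simp
  ultimately show ?thesis
    by (rule landau_o.big_trans)
qed

lemma norm_normalized_le_1: "norm (m /\<^sub>R norm m) \<le> 1"
  by (cases "m = 0") simp_all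

lemma inner_normalized: "inner m (m /\<^sub>R norm m) = norm m"
  by (cases "m = 0") (simp_all add: dot_square_norm power2_eq_square)

theorem theorem4p2:
  fixes A :: "complex ^ 'n ^ 'n"
    and U :: "real set"
    and r :: "complex \<Rightarrow> real"
    and xA yA :: "complex \<Rightarrow> complex ^ 'n"
    and x y :: "real \<Rightarrow> complex ^ 'n ^ 'n \<Rightarrow> complex \<Rightarrow> complex ^ 'n"
    and h :: "real \<Rightarrow> real"
  assumes U: "open U" "is_interval U" "0 \<in> U"
    and r_pos: "\<And>\<mu>0. \<mu>0 \<in> eigenvalues A \<Longrightarrow> r \<mu>0 > 0"
    and only_one: "\<And>\<mu>0 \<eta> \<Delta>. \<mu>0 \<in> eigenvalues A \<Longrightarrow> \<eta> \<in> U \<Longrightarrow> norm \<Delta> \<le> 1 \<Longrightarrow>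
          \<exists>\<mu>. eigenvalues (A + \<eta> *\<^sub>R \<Delta>) \<inter> ball \<mu>0 (r \<mu>0) = {\<mu>} \<and>
              simple_eigenvalue (A + \<eta> *\<^sub>R \<Delta>) \<mu>"
    and eigvecs_A: "\<And>\<mu>0. \<mu>0 \<in> eigenvalues A \<Longrightarrow> unit_eigenpair A \<mu>0 (xA \<mu>0) (yA \<mu>0)"
    and eigvecs_init: "\<And>\<mu>0 \<Delta>. \<mu>0 \<in> eigenvalues A \<Longrightarrow> \<Delta> = outer (yA \<mu>0) (xA \<mu>0) \<Longrightarrow>
          x 0 \<Delta> \<mu>0 = xA \<mu>0 \<and> y 0 \<Delta> \<mu>0 = yA \<mu>0"
    and eigvecs_pert: "\<And>\<mu>0 \<Delta> \<eta>. \<mu>0 \<in> eigenvalues A \<Longrightarrow> \<Delta> = outer (yA \<mu>0) (xA \<mu>0) \<Longrightarrow> \<eta> \<in> U \<Longrightarrow>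
          unit_eigenpair (A + \<eta> *\<^sub>R \<Delta>) (pert_eigenvalue A r \<eta> \<Delta> \<mu>0) (x \<eta> \<Delta> \<mu>0) (y \<eta> \<Delta> \<mu>0)"
    and eigvecs_analytic: "\<And>\<mu>0 \<Delta>. \<mu>0 \<in> eigenvalues A \<Longrightarrow> \<Delta> = outer (yA \<mu>0) (xA \<mu>0) \<Longrightarrow>
          (\<lambda>\<eta>. x \<eta> \<Delta> \<mu>0) real_analytic_on U \<and> (\<lambda>\<eta>. y \<eta> \<Delta> \<mu>0) real_analytic_on U"
    and h_pos: "\<And>\<epsilon>. \<epsilon> > 0 \<Longrightarrow> {0..\<epsilon>} \<subseteq> U \<Longrightarrow> h \<epsilon> > 0"
    and h_bigo: "h \<in> O[at_right 0](\<lambda>\<epsilon>. \<epsilon>)"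
  shows "(\<forall>\<epsilon>>0. {0..\<epsilon>} \<subseteq> U \<longrightarrow>
            pseudospectral_abscissa \<epsilon> A = (MAX \<mu>0\<in>eigenvalues A. max_Re_eigenvalue A r \<epsilon> \<mu>0)) \<and>
         (\<lambda>\<epsilon>. pseudospectral_abscissa \<epsilon> A
             - (MAX \<mu>0\<in>eigenvalues A. Re (pert_eigenvalue A r \<epsilon> (approx_maximizer xA yA x y (h \<epsilon>) \<epsilon> \<mu>0) \<mu>0)))
           \<in> O[at_right 0](\<lambda>\<epsilon>. \<epsilon> ^ 3) \<and>
         (\<lambda>\<epsilon>. pseudospectral_abscissa \<epsilon> A
             - (MAX \<mu>0\<in>eigenvalues A. spectral_abscissa (A + \<epsilon> *\<^sub>R approx_maximizer xA yA x y (h \<epsilon>) \<epsilon> \<mu>0)))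
           \<in> O[at_right 0](\<lambda>\<epsilon>. \<epsilon> ^ 3) \<and>
         (\<lambda>\<epsilon>. pseudospectral_abscissa \<epsilon> A
             - (MAX \<mu>0\<in>eigenvalues A.
                  Re \<mu>0 + \<epsilon> / Re (cdot (yA \<mu>0) (xA \<mu>0)) *
                    Re (mat_inner (ascent_matrix xA yA x y (h \<epsilon>) \<epsilon> \<mu>0)
                                  (approx_maximizer xA yA x y (h \<epsilon>) \<epsilon> \<mu>0))))
           \<in> O[at_right 0](\<lambda>\<epsilon>. \<epsilon> ^ 3)"
proof -
  interpret isolated_eigenvalues A U r
    by unfold_locales (use U r_pos only_one in auto)
  note in_U = eventually_in_U
  obtain H where "\<forall>\<^sub>F \<epsilon> in at_right 0. norm (h \<epsilon>) \<le> H * norm \<epsilon>"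
    using h_bigo by (elim landau_o.bigE)
  then have H: "\<forall>\<^sub>F \<epsilon> in at_right 0. h \<epsilon> \<le> H * \<epsilon>"
    using eventually_at_right_less[of 0] by eventually_elim auto
  have h_gt: "\<forall>\<^sub>F \<epsilon> in at_right 0. 0 < h \<epsilon>"
    using in_U eventually_at_right_less[of 0] by eventually_elim (use h_pos in auto)
  have "((\<lambda>\<epsilon>. H * \<epsilon>) \<longlongrightarrow> 0) (at_right 0)"
    by (intro tendsto_mult_right_zero tendsto_ident_at)
  then have "(h \<longlongrightarrow> 0) (at_right 0)"
    by (intro tendsto_sandwich[OF eventually_mono[OF h_gt less_imp_le] H tendsto_const])
  then have h_lim: "filterlim h (at_right 0) (at_right 0)"
    by (rule tendsto_imp_filterlim_at_right[OF _ h_gt])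
  let ?T = "\<lambda>\<epsilon>. approx_maximizer xA yA x y (h \<epsilon>) \<epsilon>"
  let ?O = "O[at_right 0](\<lambda>\<epsilon>::real. \<epsilon> ^ 3)"
  have asymptotics:
    "(\<lambda>\<epsilon>. max_Re_eigenvalue A r \<epsilon> \<mu>0 - Re (pert_eigenvalue A r \<epsilon> (?T \<epsilon> \<mu>0) \<mu>0)) \<in> ?O"
    "(\<lambda>\<epsilon>. max_Re_eigenvalue A r \<epsilon> \<mu>0 - (Re \<mu>0 + \<epsilon> / Re (cdot (yA \<mu>0) (xA \<mu>0)) *
        Re (mat_inner (ascent_matrix xA yA x y (h \<epsilon>) \<epsilon> \<mu>0) (?T \<epsilon> \<mu>0)))) \<in> ?O"
    if \<mu>0: "\<mu>0 \<in> eigenvalues A" for \<mu>0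
  proof -
    interpret triple: analytic_eigentriple A U r \<mu>0 "xA \<mu>0" "yA \<mu>0"
      "\<lambda>\<eta>. x \<eta> (outer (yA \<mu>0) (xA \<mu>0)) \<mu>0" "\<lambda>\<eta>. y \<eta> (outer (yA \<mu>0) (xA \<mu>0)) \<mu>0"
      by unfold_locales
        (use \<mu>0 eigvecs_A eigvecs_init eigvecs_pert eigvecs_analytic in auto)
    have ascent: "ascent_matrix xA yA x y s \<epsilon> \<mu>0 = triple.ascent s \<epsilon>" for s \<epsilon>
      by (simp add: ascent_matrix_def Let_def eigvec_quotient_def triple.ascent_def triple.W_def
          triple.\<beta>_def triple.qX_def triple.qY_def triple.D_def)
    show "(\<lambda>\<epsilon>. max_Re_eigenvalue A r \<epsilon> \<mu>0 - Re (pert_eigenvalue A r \<epsilon> (?T \<epsilon> \<mu>0) \<mu>0)) \<in> ?O"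
      unfolding approx_maximizer_def ascent by (rule triple.max_Re_ascent_direction[OF h_lim])
    show "(\<lambda>\<epsilon>. max_Re_eigenvalue A r \<epsilon> \<mu>0 - (Re \<mu>0 + \<epsilon> / Re (cdot (yA \<mu>0) (xA \<mu>0)) *
        Re (mat_inner (ascent_matrix xA yA x y (h \<epsilon>) \<epsilon> \<mu>0) (?T \<epsilon> \<mu>0)))) \<in> ?O"
      unfolding approx_maximizer_def ascent Re_mat_inner inner_normalized triple.\<kappa>_def[symmetric]
      by (rule triple.max_Re_norm_ascent[OF h_lim H])
  qed
  have first: "pseudospectral_abscissa \<epsilon> A = (MAX \<mu>0\<in>eigenvalues A. max_Re_eigenvalue A r \<epsilon> \<mu>0)"
    if "\<epsilon> > 0" "{0..\<epsilon>} \<subseteq> U" for \<epsilon>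
    using that by (intro pseudospectral_abscissa_eq_Max) auto
  have approx: "(\<lambda>\<epsilon>. pseudospectral_abscissa \<epsilon> A - (MAX \<mu>0\<in>eigenvalues A. g \<mu>0 \<epsilon>)) \<in> ?O"
    if "\<And>\<mu>0. \<mu>0 \<in> eigenvalues A \<Longrightarrow> (\<lambda>\<epsilon>. max_Re_eigenvalue A r \<epsilon> \<mu>0 - g \<mu>0 \<epsilon>) \<in> ?O" for g
  proof -
    have "\<forall>\<^sub>F \<epsilon> in at_right 0. pseudospectral_abscissa \<epsilon> A - (MAX \<mu>0\<in>eigenvalues A. g \<mu>0 \<epsilon>)
        = (MAX \<mu>0\<in>eigenvalues A. max_Re_eigenvalue A r \<epsilon> \<mu>0) - (MAX \<mu>0\<in>eigenvalues A. g \<mu>0 \<epsilon>)"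
      using in_U eventually_at_right_less[of 0] by eventually_elim (simp add: first)
    then show ?thesis
      using Max_diff_bigo[OF finite_eigenvalues eigenvalues_nonempty that]
      by (subst landau_o.big.in_cong)
  qed
  have second: "(\<lambda>\<epsilon>. pseudospectral_abscissa \<epsilon> A
      - (MAX \<mu>0\<in>eigenvalues A. Re (pert_eigenvalue A r \<epsilon> (?T \<epsilon> \<mu>0) \<mu>0))) \<in> ?O"
    by (rule approx[OF asymptotics(1)])
  have "\<forall>\<^sub>F \<epsilon> in at_right 0.
    norm (pseudospectral_abscissa \<epsilon> A
      - (MAX \<mu>0\<in>eigenvalues A. spectral_abscissa (A + \<epsilon> *\<^sub>R ?T \<epsilon> \<mu>0)))
    \<le> norm (pseudospectral_abscissa \<epsilon> A
      - (MAX \<mu>0\<in>eigenvalues A. Re (pert_eigenvalue A r \<epsilon> (?T \<epsilon> \<mu>0) \<mu>0)))"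
    using in_U eventually_at_right_less[of 0]
  proof eventually_elim
    case (elim \<epsilon>)
    then have \<epsilon>: "\<epsilon> > 0" "\<epsilon> \<in> U"
      by auto
    have T: "norm (?T \<epsilon> \<mu>0) \<le> 1" for \<mu>0
      unfolding approx_maximizer_def by (rule norm_normalized_le_1)
    have "(MAX \<mu>0\<in>eigenvalues A. spectral_abscissa (A + \<epsilon> *\<^sub>R ?T \<epsilon> \<mu>0)) \<le> pseudospectral_abscissa \<epsilon> A"
      using spectral_abscissa_le_pseudospectral_abscissa[OF \<epsilon> T]
      by (intro Max.boundedI) (auto simp: finite_eigenvalues eigenvalues_nonempty)
    moreover have "(MAX \<mu>0\<in>eigenvalues A. Re (pert_eigenvalue A r \<epsilon> (?T \<epsilon> \<mu>0) \<mu>0))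
        \<le> (MAX \<mu>0\<in>eigenvalues A. spectral_abscissa (A + \<epsilon> *\<^sub>R ?T \<epsilon> \<mu>0))"
    proof (rule Max.boundedI)
      fix t
      assume "t \<in> (\<lambda>\<mu>0. Re (pert_eigenvalue A r \<epsilon> (?T \<epsilon> \<mu>0) \<mu>0)) ` eigenvalues A"
      then obtain \<mu>0 where \<mu>0: "\<mu>0 \<in> eigenvalues A" "t = Re (pert_eigenvalue A r \<epsilon> (?T \<epsilon> \<mu>0) \<mu>0)"
        by blast
      then have "t \<le> spectral_abscissa (A + \<epsilon> *\<^sub>R ?T \<epsilon> \<mu>0)"
        using Re_eig_le_spectral_abscissa[OF \<mu>0(1) \<epsilon>(2) T] by simp
      also have "\<dots> \<le> (MAX \<mu>0\<in>eigenvalues A. spectral_abscissa (A + \<epsilon> *\<^sub>R ?T \<epsilon> \<mu>0))"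
        using \<mu>0(1) by (simp add: finite_eigenvalues)
      finally show "t \<le> (MAX \<mu>0\<in>eigenvalues A. spectral_abscissa (A + \<epsilon> *\<^sub>R ?T \<epsilon> \<mu>0))" .
    qed (simp_all add: finite_eigenvalues eigenvalues_nonempty)
    ultimately show ?case
      by simp
  qed
  then have third: "(\<lambda>\<epsilon>. pseudospectral_abscissa \<epsilon> A
      - (MAX \<mu>0\<in>eigenvalues A. spectral_abscissa (A + \<epsilon> *\<^sub>R ?T \<epsilon> \<mu>0))) \<in> ?O"
    by (rule landau_o.big_trans[OF landau_o.big_mono second])
  show ?thesis
    using first second third approx[OF asymptotics(2)] by blast
qed

end
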